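(* Under the dyadic policy $\pi_D$, $$R(\pi_D,N)=H\left(\mathrm{Bin}\left(k,\tfrac12\right)\right).$$ Moreover, the dyadic policy is optimal among all non-adaptive policies, i.e. $R(\pi_D,N)=\sup_{\pi\in\Pi_N}R(\pi,N)$.
   Context: Setting. $\log$ is the logarithm to base 2. Let $k\ge 1$, $N\ge1$ be integers. $\theta=(\theta_1,\dots,\theta_k)$ is a random vector in $\mathbb R^k$ whose coordinates are i.i.d. with Lebesgue density $f_0$ on $\mathbb R$, so $\theta$ has density $p_0(u)=\prod_{i=1}^k f_0(u_i)$; the differential entropy $H_0=H(p_0)$ is assumed finite, where for a density $p$ on $\mathbb R^k$, $H(p)=-\int_{\mathbb R^k} p(u)\log p(u)\,du$. $Z$ is uniform on $[0,1]$ and independent of $\theta$. Policies. A policy is a sequence $\pi=(\pi_1,\dots,\pi_N)$ where $\pi_n$ is a Borel subset of $[0,1]\times\{0,1,\dots,k\}^{n-1}\times\mathbb R$; $\Pi$ is the set of all policies. Under $\pi$, the question sets and answers are defined recursively for $n=1,\dots,N$ by $A_n=\{t\in\mathbb R:(Z,X_1,\dots,X_{n-1},t)\in\pi_n\}$ and $X_n=\mathbb 1_{A_n}(\theta_1)+\dots+\mathbb 1_{A_n}(\theta_k)$. The set $\Pi_N\subset\Pi$ of non-adaptive policies consists of those policies under which each $A_n$ depends only on $Z$. Posterior and rate. $p_n$ is the conditional (posterior) density of $\theta$ given the history $B_n=(Z,A_1,\dots,A_n,X_1,\dots,X_n)$: $p_n(u)$ is proportional to $p_0(u)$ on the set $\{u\in\mathbb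 R^k: X_m=\sum_{i=1}^k\mathbb 1_{A_m}(u_i),\ 1\le m\le n\}$ and is $0$ outside. The rate of reduction in expected entropy is $R(\pi,N)=\frac{H_0-E^\pi[H(p_N)]}{N}$. Dyadic policy. Let $F_0$ be the cumulative distribution function of $f_0$, $Q(p)=\inf\{u\in\mathbb R:p\le F_0(u)\}$ for $p\in[0,1]$ (possibly $\pm\infty$ at $p=0,1$), and $\mathrm{supp}(f_0)=\{u\in\mathbb R:f_0(u)>0\}$. The dyadic policy $\pi_D$ asks, deterministically, the questions $A_n=\left(\bigcup_{j=1}^{2^{n-1}}\left(Q\left(\frac{2j-1}{2^n}\right),Q\left(\frac{2j}{2^n}\right)\right]\right)\cap\mathrm{supp}(f_0)$, $n\ge1$. $H(\mathrm{Bin}(k,\frac12))$ is the discrete (Shannon, base 2) entropy of the Binomial distribution with parameters $k$ and $\frac12$. *)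

theory Defs
  imports "HOL-Probability.Probability"
begin

text \<open>
  \<open>\<real>\<^sup>k\<close> with Lebesgue measure is \<^term>\<open>Pi\<^sub>M {1..k} (\<lambda>_. lborel :: real measure)\<close>: its points are the
  functions \<^typ>\<open>nat \<Rightarrow> real\<close> that are \<^const>\<open>undefined\<close> outside \<open>{1..k}\<close>.
\<close>

abbreviation lborel_pow :: "nat \<Rightarrow> (nat \<Rightarrow> real) measure" where
  "lborel_pow k \<equiv> Pi\<^sub>M {1..k} (\<lambda>_. lborel)"

definition prior :: "(real \<Rightarrow> real) \<Rightarrow> nat \<Rightarrow> (nat \<Rightarrow> real) \<Rightarrow> real" where
  "prior f0 k u = (\<Prod>i=1..k. f0 (u i))"

text \<open>The convention \<open>0 log 0 = 0\<close> is built in, since \<open>log 2 0 = 0\<close>.\<close>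

definition diff_entropy :: "nat \<Rightarrow> ((nat \<Rightarrow> real) \<Rightarrow> real) \<Rightarrow> real" where
  "diff_entropy k p = - (\<integral>u. p u * log 2 (p u) \<partial>lborel_pow k)"

definition shannon_entropy :: "'a pmf \<Rightarrow> real" where
  "shannon_entropy p = prob_space.entropy (measure_pmf p) 2 (count_space UNIV) (\<lambda>x. x)"

lemma shannon_entropy_eq_sum:
  fixes p :: "'a :: countable pmf"
  assumes "finite (set_pmf p)"
  shows "shannon_entropy p = - (\<Sum>x\<in>set_pmf p. pmf p x * log 2 (pmf p x))"
proof -
  interpret information_space "measure_pmf p" 2
    by unfold_locales auto
  have "distributed (measure_pmf p) (count_space UNIV) (\<lambda>x. x) (\<lambda>x. ennreal (pmf p x))"
    by (simp add: distributed_def measure_pmf_eq_density[symmetric] distr_id2)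
  then have "shannon_entropy p = - (\<integral>x. pmf p x * log 2 (pmf p x) \<partial>count_space UNIV)"
    unfolding shannon_entropy_def by (intro entropy_distr) auto
  also have "(\<integral>x. pmf p x * log 2 (pmf p x) \<partial>count_space UNIV)
      = (\<Sum>x\<in>set_pmf p. pmf p x * log 2 (pmf p x))"
    using assms
    by (subst lebesgue_integral_count_space_finite_support)
       (auto intro!: sum.mono_neutral_left simp: set_pmf_iff elim: finite_subset[rotated])
  finally show ?thesis .
qed

text \<open>
  The \<open>n\<close>-th component of a policy (for \<open>n \<ge> 1\<close>) is a set of triples \<open>(z, (x\<^sub>1, \<dots>, x\<^sub>n\<^sub>-\<^sub>1), t)\<close>,
  where the tuple of answers is an extensional function on \<open>{1..<n}\<close>.
\<close>

type_synonym policy = "nat \<Rightarrow> (real \<times> (nat \<Rightarrow> nat) \<times> real) set"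

definition policies :: "nat \<Rightarrow> nat \<Rightarrow> policy set" where
  "policies k N = {\<pi>. \<forall>n\<in>{1..N}. \<pi> n \<in> sets (restrict_space borel {0..1} \<Otimes>\<^sub>M
      (Pi\<^sub>M {1..<n} (\<lambda>_. count_space {0..k}) \<Otimes>\<^sub>M borel))}"

text \<open>
  \<open>history k \<pi> z u n\<close> is the tuple \<open>(X\<^sub>1, \<dots>, X\<^sub>n)\<close> of answers on the event \<open>Z = z\<close>, \<open>\<theta> = u\<close>.
\<close>

primrec history :: "nat \<Rightarrow> policy \<Rightarrow> real \<Rightarrow> (nat \<Rightarrow> real) \<Rightarrow> nat \<Rightarrow> (nat \<Rightarrow> nat)" where
  "history k \<pi> z u 0 = (\<lambda>_. undefined)"
| "history k \<pi> z u (Suc n) = (history k \<pi> z u n)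
     (Suc n := (\<Sum>i=1..k. indicator {t. (z, history k \<pi> z u n, t) \<in> \<pi> (Suc n)} (u i)))"

definition question :: "nat \<Rightarrow> policy \<Rightarrow> real \<Rightarrow> (nat \<Rightarrow> real) \<Rightarrow> nat \<Rightarrow> real set" where
  "question k \<pi> z u n = {t. (z, history k \<pi> z u (n - 1), t) \<in> \<pi> n}"

definition answer :: "nat \<Rightarrow> policy \<Rightarrow> real \<Rightarrow> (nat \<Rightarrow> real) \<Rightarrow> nat \<Rightarrow> nat" where
  "answer k \<pi> z u n = (\<Sum>i=1..k. indicator (question k \<pi> z u n) (u i))"

lemma history_eq_restrict_answer: "history k \<pi> z u n = restrict (answer k \<pi> z u) {1..n}"
proof (induction n)
  case 0
  show ?case by (simp add: restrict_def)
next
  case (Suc n)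
  have "history k \<pi> z u (Suc n) = (history k \<pi> z u n)(Suc n := answer k \<pi> z u (Suc n))"
    by (simp add: answer_def question_def)
  then show ?case by (auto simp: Suc.IH fun_eq_iff)
qed

definition nonadaptive_policies :: "nat \<Rightarrow> nat \<Rightarrow> policy set" where
  "nonadaptive_policies k N = {\<pi> \<in> policies k N. \<forall>n\<in>{1..N}. \<forall>z\<in>{0..1}.
      \<forall>u\<in>space (lborel_pow k). \<forall>v\<in>space (lborel_pow k).
        question k \<pi> z u n = question k \<pi> z v n}"

definition consistent :: "nat \<Rightarrow> policy \<Rightarrow> real \<Rightarrow> (nat \<Rightarrow> real) \<Rightarrow> nat \<Rightarrow> (nat \<Rightarrow> real) set" where
  "consistent k \<pi> z u n = {v \<in> space (lborel_pow k). \<forall>m\<in>{1..n}.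
      answer k \<pi> z u m = (\<Sum>i=1..k. indicator (question k \<pi> z u m) (v i))}"

text \<open>\<open>posterior f0 k \<pi> z u n\<close> is the density \<open>p\<^sub>n\<close> on the event \<open>Z = z\<close>, \<open>\<theta> = u\<close>.\<close>

definition posterior ::
  "(real \<Rightarrow> real) \<Rightarrow> nat \<Rightarrow> policy \<Rightarrow> real \<Rightarrow> (nat \<Rightarrow> real) \<Rightarrow> nat \<Rightarrow> (nat \<Rightarrow> real) \<Rightarrow> real" where
  "posterior f0 k \<pi> z u n v = indicator (consistent k \<pi> z u n) v * prior f0 k v /
     (\<integral>w. indicator (consistent k \<pi> z u n) w * prior f0 k w \<partial>lborel_pow k)"

definition entropy_rate ::
  "'a measure \<Rightarrow> ('a \<Rightarrow> real) \<Rightarrow> ('a \<Rightarrow> nat \<Rightarrow> real) \<Rightarrow> (real \<Rightarrow> real) \<Rightarrow> nat \<Rightarrow> policy \<Rightarrow> nat \<Rightarrow> real"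
  where
  "entropy_rate M Z \<theta> f0 k \<pi> N =
     (diff_entropy k (prior f0 k)
        - (\<integral>\<omega>. diff_entropy k (posterior f0 k \<pi> (Z \<omega>) (\<theta> \<omega>) N) \<partial>M)) / real N"

definition quantile :: "(real \<Rightarrow> real) \<Rightarrow> real \<Rightarrow> ereal" where
  "quantile f0 p = Inf {ereal u | u. p \<le> cdf (density lborel (\<lambda>x. ennreal (f0 x))) u}"

definition dyadic_question :: "(real \<Rightarrow> real) \<Rightarrow> nat \<Rightarrow> real set" where
  "dyadic_question f0 n =
     (\<Union>j\<in>{1..2 ^ (n - 1)}. {t. quantile f0 ((2 * real j - 1) / 2 ^ n) < ereal t \<and>
                                ereal t \<le> quantile f0 (2 * real j / 2 ^ n)})
     \<inter> {t. f0 t > 0}"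

definition dyadic_policy :: "(real \<Rightarrow> real) \<Rightarrow> nat \<Rightarrow> policy" where
  "dyadic_policy f0 k n =
     {0..1} \<times> (Pi\<^sub>E {1..<n} (\<lambda>_. {0..k}) \<times> dyadic_question f0 n)"

end

theory Submission
  imports Defs
begin

text \<open>
  Fix \<open>z\<close> and let \<open>T\<close> be the vector of answers. Conditioning a density \<open>p\<close> on the events \<open>T = x\<close>
  lowers its expected differential entropy by exactly the Shannon entropy \<open>H(T)\<close>. For a non-adaptive
  policy, the answer \<open>X\<^sub>n\<close> is binomial with parameters \<open>k\<close> and \<open>q\<^sub>n = \<mu>(A\<^sub>n)\<close>, so subadditivity of
  entropy gives \<open>H(T) \<le> \<Sum>n\<le>N. H(Bin(k, q\<^sub>n)) \<le> N * H(Bin(k, 1/2))\<close>. The dyadic questions are independent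
  events of probability \<open>1/2\<close> under \<open>\<mu>\<close>, which makes the answers independent \<open>Bin(k, 1/2)\<close> variables
  and turns both inequalities into equalities.

  That \<open>q = 1/2\<close> maximises \<open>h(q) = H(Bin(k, q))\<close> follows from \<open>h'(q) = k (\<phi>(q) - \<phi>(1 - q))\<close> (in nats) with
  \<open>\<phi>(q) = E ln (1 + Bin(k - 1, q)) - ln q\<close>: the function \<open>\<phi>\<close> is decreasing, because
  \<open>ln (1 + 1/(j + 1)) \<le> 1/(j + 1)\<close> and \<open>(k - 1) q E[1/(1 + Bin(k - 2, q))] = 1 - (1 - q)\<^sup>k\<^sup>-\<^sup>1 \<le> 1\<close>.
\<close>

section \<open>The entropy of the binomial distribution\<close>

text \<open>The expectation of \<open>g\<close> under Bin(\<open>k\<close>, \<open>q\<close>),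
  written as a polynomial in \<open>q\<close> so that it makes sense for every real \<open>q\<close>
  and can be differentiated without side conditions.\<close>

definition binom_mean :: "nat \<Rightarrow> real \<Rightarrow> (nat \<Rightarrow> real) \<Rightarrow> real" where
  "binom_mean k q g = (\<Sum>j\<le>k. real (k choose j) * q ^ j * (1 - q) ^ (k - j) * g j)"

lemma binom_mean_0 [simp]: "binom_mean 0 q g = g 0"
  by (simp add: binom_mean_def)

text \<open>Conditioning on the outcome of one of the \<open>k + 1\<close> trials; at the level of
  sums this is Pascal's rule.\<close>

lemma binom_mean_Suc:
  "binom_mean (Suc k) q g = (1 - q) * binom_mean k q g + q * binom_mean k q (\<lambda>j. g (Suc j))"
proof -
  have "binom_mean (Suc k) q g = (1 - q) ^ Suc k * g 0 +
      (\<Sum>j\<le>k. real (Suc k choose Suc j) * q ^ Suc j * (1 - q) ^ (k - j) * g (Suc j))"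
    by (simp add: binom_mean_def sum.atMost_Suc_shift del: sum.atMost_Suc binomial_Suc_Suc power_Suc)
  also have "\<dots> = (1 - q) ^ Suc k * g 0 +
      (\<Sum>j\<le>k. real (k choose Suc j) * q ^ Suc j * (1 - q) ^ (k - j) * g (Suc j)) +
      q * binom_mean k q (\<lambda>j. g (Suc j))"
    by (simp add: binom_mean_def sum_distrib_left sum.distrib[symmetric] algebra_simps)
  also have "(1 - q) ^ Suc k * g 0 +
      (\<Sum>j\<le>k. real (k choose Suc j) * q ^ Suc j * (1 - q) ^ (k - j) * g (Suc j))
    = (\<Sum>j\<le>Suc k. real (k choose j) * q ^ j * (1 - q) ^ (Suc k - j) * g j)"
    by (simp add: sum.atMost_Suc_shift del: sum.atMost_Suc power_Suc)
  also have "\<dots> = (1 - q) * binom_mean k q g"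
    by (simp add: binom_mean_def sum_distrib_left Suc_diff_le algebra_simps)
  finally show ?thesis .
qed

lemma binom_mean_cong:
  "(\<And>j. j \<le> k \<Longrightarrow> g j = h j) \<Longrightarrow> binom_mean k q g = binom_mean k q h"
  by (simp add: binom_mean_def)

lemma binom_mean_add: "binom_mean k q (\<lambda>j. g j + h j) = binom_mean k q g + binom_mean k q h"
  by (simp add: binom_mean_def sum.distrib algebra_simps)

lemma binom_mean_diff: "binom_mean k q (\<lambda>j. g j - h j) = binom_mean k q g - binom_mean k q h"
  by (simp add: binom_mean_def sum_subtractf algebra_simps)

lemma binom_mean_cmult: "binom_mean k q (\<lambda>j. c * g j) = c * binom_mean k q g"
  by (simp add: binom_mean_def sum_distrib_left algebra_simps)

lemma binom_mean_mono:
  assumes "0 \<le> q" "q \<le> 1" "\<And>j. j \<le> k \<Longrightarrow> g j \<le> h j"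
  shows "binom_mean k q g \<le> binom_mean k q h"
  unfolding binom_mean_def using assms by (intro sum_mono mult_left_mono) auto

lemma binom_mean_const: "binom_mean k q (\<lambda>_. c) = c"
  by (induction k) (simp_all add: binom_mean_Suc algebra_simps)

lemma binom_mean_id: "binom_mean k q real = real k * q"
proof (induction k)
  case (Suc k)
  have "binom_mean k q (\<lambda>j. real (Suc j)) = real k * q + 1"
    using binom_mean_add[of k q real "\<lambda>_. 1"] Suc by (simp add: binom_mean_const add.commute)
  then show ?case by (simp only: binom_mean_Suc Suc) (simp add: algebra_simps)
qed simp

text \<open>Exchanging successes and failures turns Bin(k, q) into Bin(k, 1 - q).\<close>

lemma binom_mean_flip: "binom_mean k (1 - q) g = binom_mean k q (\<lambda>j. g (k - j))"
proof -
  have "binom_mean k (1 - q) g = (\<Sum>j\<le>k. real (k choose (k - j)) * (1 - q) ^ (k - j) * q ^ (k - (k - j)) * g (k - j))"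
    unfolding binom_mean_def by (rule sum.reindex_bij_witness[of _ "\<lambda>j. k - j" "\<lambda>j. k - j"]) auto
  also have "\<dots> = binom_mean k q (\<lambda>j. g (k - j))"
    unfolding binom_mean_def by (intro sum.cong refl) (simp add: binomial_symmetric[symmetric])
  finally show ?thesis .
qed

text \<open>The rule for Bernstein polynomials: differentiation uses up one of the \<open>k\<close>
  trials and replaces \<open>g\<close> by its forward difference. At \<open>k = 0\<close> the
  truncated \<open>k - 1\<close> is harmless because of the factor \<open>real k\<close>.\<close>

lemma binom_mean_has_derivative:
  "((\<lambda>q. binom_mean k q g) has_real_derivative
     real k * binom_mean (k - 1) q (\<lambda>j. g (Suc j) - g j)) (at q)"
proof (induction k arbitrary: g)
  case (Suc k)
  let ?d = "\<lambda>g. real k * binom_mean (k - 1) q (\<lambda>j. g (Suc j) - g j)"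
  have "((\<lambda>q. binom_mean (Suc k) q g) has_real_derivative
      (- binom_mean k q g + (1 - q) * ?d g) +
      (binom_mean k q (\<lambda>j. g (Suc j)) + q * ?d (\<lambda>j. g (Suc j)))) (at q)"
    unfolding binom_mean_Suc
    by (auto intro!: derivative_eq_intros Suc.IH[of g] Suc.IH[of "\<lambda>j. g (Suc j)"])
  \<comment> \<open>The two inherited derivatives recombine by the one-trial recursion, read from
    level \<open>k - 1\<close> to level \<open>k\<close>; for \<open>k = 0\<close> both sides
    vanish.\<close>
  moreover have "(1 - q) * ?d g + q * ?d (\<lambda>j. g (Suc j)) = real k * binom_mean k q (\<lambda>j. g (Suc j) - g j)"
    by (cases k) (simp_all add: binom_mean_Suc algebra_simps)
  ultimately show ?case
    by (elim DERIV_cong) (simp add: binom_mean_diff algebra_simps)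
qed simp

text \<open>The factor \<open>(k + 1) q\<close> is absorbed by shifting the binomial coefficients, as
  \<open>(k + 1) / (j + 1) * (k choose j) = (k + 1 choose j + 1)\<close>.\<close>

lemma binom_mean_inverse_Suc:
  "real (Suc k) * q * binom_mean k q (\<lambda>j. 1 / real (Suc j)) = 1 - (1 - q) ^ Suc k"
proof -
  have "real (Suc k) * q * binom_mean k q (\<lambda>j. 1 / real (Suc j)) =
     (\<Sum>j\<le>k. real (Suc k choose Suc j) * q ^ Suc j * (1 - q) ^ (k - j))"
    unfolding binom_mean_def sum_distrib_left
  proof (intro sum.cong refl)
    fix j
    have "real (Suc k) * real (k choose j) = real (Suc k choose Suc j) * real (Suc j)"
      using Suc_times_binomial_eq[of k j] by (metis of_nat_mult)
    then have "real (Suc k) * real (k choose j) / real (Suc j) = real (Suc k choose Suc j)"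
      by (simp add: field_simps del: binomial_Suc_Suc)
    moreover have "real (Suc k) * q * (real (k choose j) * q ^ j * (1 - q) ^ (k - j) * (1 / real (Suc j))) =
      (real (Suc k) * real (k choose j) / real (Suc j)) * q ^ Suc j * (1 - q) ^ (k - j)"
      by (simp add: mult_ac del: of_nat_Suc)
    ultimately show "real (Suc k) * q * (real (k choose j) * q ^ j * (1 - q) ^ (k - j) * (1 / real (Suc j))) =
      real (Suc k choose Suc j) * q ^ Suc j * (1 - q) ^ (k - j)"
      by (simp only:)
  qed
  also have "\<dots> = binom_mean (Suc k) q (\<lambda>_. 1) - (1 - q) ^ Suc k"
    by (simp add: binom_mean_def sum.atMost_Suc_shift del: sum.atMost_Suc binomial_Suc_Suc power_Suc)
  finally show ?thesis by (simp add: binom_mean_const)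
qed


section \<open>Maximality of the binomial entropy at q = 1/2\<close>

lemma ln_Suc_diff_le: "ln (real (Suc (Suc j))) - ln (real (Suc j)) \<le> 1 / real (Suc j)"
  using ln_diff_le[of "real (Suc (Suc j))" "real (Suc j)"] by simp

text \<open>The function called phi in the overview, with \<open>m\<close> for k - 1. By
  \<open>binom_mean_inverse_Suc\<close> the derivative of the mean never exceeds 1/q, the derivative
  of ln.\<close>

lemma binom_mean_ln_minus_ln_antimono:
  assumes "0 < a" "a \<le> b" "b < 1"
  shows "binom_mean m b (\<lambda>j. ln (real (Suc j))) - ln b \<le> binom_mean m a (\<lambda>j. ln (real (Suc j))) - ln a"
proof (rule DERIV_nonpos_imp_nonincreasing[OF \<open>a \<le> b\<close>])
  fix q assume "a \<le> q" "q \<le> b"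
  then have q: "0 < q" "q < 1" using assms by auto
  let ?D = "real m * binom_mean (m - 1) q (\<lambda>j. ln (real (Suc (Suc j))) - ln (real (Suc j)))"
  have "((\<lambda>q. binom_mean m q (\<lambda>j. ln (real (Suc j))) - ln q) has_real_derivative ?D - 1 / q) (at q)"
    using q by (auto intro!: derivative_eq_intros binom_mean_has_derivative simp: divide_inverse)
  moreover have "?D \<le> 1 / q"
  proof (cases m)
    case (Suc l)
    have "?D \<le> real (Suc l) * binom_mean l q (\<lambda>j. 1 / real (Suc j))"
      unfolding Suc diff_Suc_1 using q
      by (intro mult_left_mono binom_mean_mono ln_Suc_diff_le) auto
    also have "\<dots> = (1 - (1 - q) ^ Suc l) / q"
      using binom_mean_inverse_Suc[of l q] q by (simp add: field_simps)
    also have "\<dots> \<le> 1 / q"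
      using q by (intro divide_right_mono) auto
    finally show ?thesis .
  qed (use q in simp)
  ultimately show "\<exists>y. ((\<lambda>q. binom_mean m q (\<lambda>j. ln (real (Suc j))) - ln q) has_real_derivative y) (at q) \<and> y \<le> 0"
    by (intro exI[of _ "?D - 1 / q"]) simp
qed

text \<open>For \<open>q\<close> in [0, 1] this is the entropy of Bin(\<open>k\<close>,
  \<open>q\<close>) in bits. A term of mass 0 is killed by its weight, so the endpoints need no
  separate convention.\<close>

definition binom_entropy :: "nat \<Rightarrow> real \<Rightarrow> real" where
  "binom_entropy k q = - binom_mean k q (\<lambda>j. log 2 (real (k choose j) * q ^ j * (1 - q) ^ (k - j)))"

lemma binom_entropy_flip: "binom_entropy k (1 - q) = binom_entropy k q"
  unfolding binom_entropy_def binom_mean_flip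
  by (intro arg_cong[where f = uminus] binom_mean_cong) (simp add: binomial_symmetric[symmetric] mult_ac)

text \<open>The logarithm of the mass at j is ln (k choose j) plus an affine function of j, and j
  has mean k q. The factor \<open>ln 2\<close> passes to nats, and the right-hand side is ready to
  be differentiated.\<close>

lemma binom_entropy_eq:
  assumes "0 < q" "q < 1"
  shows "binom_entropy k q * ln 2 =
    - binom_mean k q (\<lambda>j. ln (real (k choose j))) - real k * (q * ln q + (1 - q) * ln (1 - q))"
proof -
  have "binom_entropy k q * ln 2 =
      - binom_mean k q (\<lambda>j. ln (real (k choose j) * q ^ j * (1 - q) ^ (k - j)))"
    using binom_mean_cmult[of k q "1 / ln 2"] by (simp add: binom_entropy_def log_def)
  also have "binom_mean k q (\<lambda>j. ln (real (k choose j) * q ^ j * (1 - q) ^ (k - j))) =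
      binom_mean k q (\<lambda>j. ln (real (k choose j)) + ((ln q - ln (1 - q)) * real j + real k * ln (1 - q)))"
    using assms by (intro binom_mean_cong) (simp add: ln_mult ln_realpow of_nat_diff algebra_simps)
  also have "\<dots> = binom_mean k q (\<lambda>j. ln (real (k choose j))) +
      ((ln q - ln (1 - q)) * (real k * q) + real k * ln (1 - q))"
    by (simp only: binom_mean_add binom_mean_cmult binom_mean_id binom_mean_const)
  finally show ?thesis by (simp add: algebra_simps)
qed

text \<open>The ratio of consecutive coefficients is (m + 1 - j)/(j + 1): both absorption identities
  lead to (m + 1) times (m choose j).\<close>

lemma ln_binomial_Suc_diff:
  assumes "j \<le> m"
  shows "ln (real (Suc m choose Suc j)) - ln (real (Suc m choose j)) =
    ln (real (Suc (m - j))) - ln (real (Suc j))"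
proof -
  have "Suc j * (Suc m choose Suc j) = Suc (m - j) * (Suc m choose j)"
    using binomial_absorb_comp[of "Suc m" j] binomial_absorption[of j "Suc m"] assms
    by (simp add: Suc_diff_le del: binomial_Suc_Suc)
  then have "real (Suc j) * real (Suc m choose Suc j) = real (Suc (m - j)) * real (Suc m choose j)"
    by (metis of_nat_mult)
  moreover have "0 < real (Suc m choose Suc j)" "0 < real (Suc m choose j)"
    using assms by (simp_all del: binomial_Suc_Suc)
  ultimately have "ln (real (Suc j)) + ln (real (Suc m choose Suc j)) =
      ln (real (Suc (m - j))) + ln (real (Suc m choose j))"
    by (metis ln_mult_pos of_nat_0_less_iff zero_less_Suc)
  then show ?thesis by linarith
qed

lemma binom_entropy_mono:
  assumes "0 < a" "a \<le> b" "b \<le> 1 / 2"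
  shows "binom_entropy k a \<le> binom_entropy k b"
proof (cases k)
  case (Suc m)
  let ?F = "\<lambda>q. - binom_mean k q (\<lambda>j. ln (real (k choose j))) - real k * (q * ln q + (1 - q) * ln (1 - q))"
  let ?\<phi> = "\<lambda>q. binom_mean m q (\<lambda>j. ln (real (Suc j))) - ln q"
  have "?F a \<le> ?F b"
  proof (rule DERIV_nonneg_imp_nondecreasing[OF \<open>a \<le> b\<close>])
    fix q assume "a \<le> q" "q \<le> b"
    then have q: "0 < q" "q \<le> 1 - q" "1 - q < 1" using assms by auto
    have \<eta>: "((\<lambda>q. q * ln q + (1 - q) * ln (1 - q)) has_real_derivative ln q - ln (1 - q)) (at q)"
      using q by (auto intro!: derivative_eq_intros simp: minus_divide_left[symmetric])
    have F': "(?F has_real_derivative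
        - (real k * binom_mean (k - 1) q (\<lambda>j. ln (real (k choose Suc j)) - ln (real (k choose j))))
        - real k * (ln q - ln (1 - q))) (at q)"
      by (intro DERIV_diff DERIV_minus DERIV_cmult binom_mean_has_derivative \<eta>)
    \<comment> \<open>After exchanging successes and failures, ln (m - j + 1) becomes ln (j + 1);
      this is where the value of phi at 1 - q comes from.\<close>
    have *: "binom_mean (k - 1) q (\<lambda>j. ln (real (k choose Suc j)) - ln (real (k choose j))) =
      binom_mean m (1 - q) (\<lambda>j. ln (real (Suc j))) - binom_mean m q (\<lambda>j. ln (real (Suc j)))"
      unfolding Suc diff_Suc_1 binom_mean_flip binom_mean_diff[symmetric]
      by (intro binom_mean_cong ln_binomial_Suc_diff)
    have "(?F has_real_derivative real k * (?\<phi> q - ?\<phi> (1 - q))) (at q)"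
      using F' unfolding * by (rule DERIV_cong) (simp add: algebra_simps)
    moreover have "0 \<le> real k * (?\<phi> q - ?\<phi> (1 - q))"
      using binom_mean_ln_minus_ln_antimono[of q "1 - q" m] q by simp
    ultimately show "\<exists>y. (?F has_real_derivative y) (at q) \<and> 0 \<le> y"
      by blast
  qed
  then have "binom_entropy k a * ln 2 \<le> binom_entropy k b * ln 2"
    using assms by (simp add: binom_entropy_eq)
  then show ?thesis by simp
qed (simp add: binom_entropy_def)

lemma binom_entropy_nonneg:
  assumes "0 \<le> q" "q \<le> 1"
  shows "0 \<le> binom_entropy k q"
proof -
  define b where "b j = real (k choose j) * q ^ j * (1 - q) ^ (k - j)" for j
  have b: "0 \<le> b j" for j using assms by (simp add: b_def)
  have "(\<Sum>j\<le>k. b j) = 1"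
    using binom_mean_const[of k q 1] by (simp add: binom_mean_def b_def)
  then have b1: "b j \<le> 1" if "j \<le> k" for j
    using member_le_sum[of j "{..k}" b] that b by simp
  have "log 2 (b j) \<le> 0" if "j \<le> k" for j
    using b[of j] b1[OF that] by (cases "b j = 0") (simp add: log_def, simp)
  then have "binom_mean k q (\<lambda>j. log 2 (b j)) \<le> binom_mean k q (\<lambda>_. 0)"
    using assms b by (intro binom_mean_mono) auto
  then show ?thesis by (simp add: binom_entropy_def b_def binom_mean_const)
qed

lemma binom_entropy_0: "binom_entropy k 0 = 0"
  by (auto simp: binom_entropy_def binom_mean_def power_0_left intro!: sum.neutral)

text \<open>Monotonicity covers 0 < q <= 1/2, and the symmetry of q and 1 - q covers the upper half.
  At q = 0, where ln q blocks the derivative argument, the entropy is 0 and nonnegativity at 1/2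
  suffices.\<close>

lemma binom_entropy_le_half:
  assumes "0 \<le> q" "q \<le> 1"
  shows "binom_entropy k q \<le> binom_entropy k (1 / 2)"
proof -
  have *: "binom_entropy k p \<le> binom_entropy k (1 / 2)" if "0 \<le> p" "p \<le> 1 / 2" for p
    using that binom_entropy_mono[of p "1 / 2" k] binom_entropy_nonneg[of "1 / 2" k]
    by (cases "p = 0") (auto simp: binom_entropy_0)
  show ?thesis
    using *[of q] *[of "1 - q"] assms by (cases "q \<le> 1 / 2") (auto simp: binom_entropy_flip)
qed

lemma shannon_entropy_binomial_half:
  "shannon_entropy (binomial_pmf k (1 / 2)) = binom_entropy k (1 / 2)"
  by (subst shannon_entropy_eq_sum)
     (auto simp: set_pmf_binomial_eq binom_entropy_def binom_mean_def)

section \<open>Entropy of finite-valued random variables\<close>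

text \<open>Termwise this is ln (r/p) <= r/p - 1. The third hypothesis is absolute continuity: since
  \<open>log 2 0 = 0\<close>, a zero of \<open>r\<close> inside the support of \<open>p\<close>
  would contribute 0 instead of minus infinity.\<close>

lemma gibbs_inequality:
  fixes p r :: "'x \<Rightarrow> real"
  assumes "\<And>x. x \<in> \<Omega> \<Longrightarrow> 0 \<le> p x" "\<And>x. x \<in> \<Omega> \<Longrightarrow> 0 \<le> r x"
    and "\<And>x. x \<in> \<Omega> \<Longrightarrow> 0 < p x \<Longrightarrow> 0 < r x"
    and "(\<Sum>x\<in>\<Omega>. r x) \<le> (\<Sum>x\<in>\<Omega>. p x)"
  shows "(\<Sum>x\<in>\<Omega>. p x * log 2 (r x)) \<le> (\<Sum>x\<in>\<Omega>. p x * log 2 (p x))"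
proof -
  have "p x * log 2 (r x) - p x * log 2 (p x) \<le> (r x - p x) / ln 2" if "x \<in> \<Omega>" for x
  proof (cases "p x = 0")
    case False
    then have "0 < p x" "0 < r x" using assms that by (auto simp: less_le)
    then have "p x * (ln (r x) - ln (p x)) \<le> p x * ((r x - p x) / p x)"
      by (intro mult_left_mono ln_diff_le) auto
    then have "p x * (ln (r x) - ln (p x)) / ln 2 \<le> (r x - p x) / ln 2"
      using \<open>0 < p x\<close> by (intro divide_right_mono) auto
    then show ?thesis by (simp add: log_def right_diff_distrib diff_divide_distrib)
  qed (use assms that in auto)
  then have "(\<Sum>x\<in>\<Omega>. p x * log 2 (r x) - p x * log 2 (p x)) \<le> (\<Sum>x\<in>\<Omega>. (r x - p x) / ln 2)"
    by (rule sum_mono)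
  also have "\<dots> \<le> 0"
    using assms(4) by (simp add: sum_divide_distrib[symmetric] sum_subtractf divide_le_0_iff)
  finally show ?thesis by (simp add: sum_subtractf)
qed

lemma (in finite_measure) integral_finite_valued:
  fixes f :: "'x \<Rightarrow> real"
  assumes T: "T \<in> M \<rightarrow>\<^sub>M count_space \<Omega>" and "finite \<Omega>"
  shows "(\<integral>u. f (T u) \<partial>M) = (\<Sum>x\<in>\<Omega>. measure M {u \<in> space M. T u = x} * f x)"
    and "integrable M (\<lambda>u. f (T u))"
proof -
  have T': "{u \<in> space M. T u = x} \<in> sets M" if "x \<in> \<Omega>" for x
  proof -
    have "T -` {x} \<inter> space M \<in> sets M" using T that by (auto intro: measurable_sets)
    then show ?thesis by (simp add: vimage_def Int_def conj_commute)
  qed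
  have eq: "f (T u) = (\<Sum>x\<in>\<Omega>. indicator {u \<in> space M. T u = x} u * f x)" if "u \<in> space M" for u
  proof -
    have "T u \<in> \<Omega>" using T that by (auto dest: measurable_space)
    then show ?thesis
      using \<open>finite \<Omega>\<close> that by (simp add: indicator_def sum.delta if_distrib[of "\<lambda>b. b * _"] cong: if_cong)
  qed
  have int: "integrable M (\<lambda>u. indicator {u \<in> space M. T u = x} u * f x)" if "x \<in> \<Omega>" for x
    using T'[OF that] by (intro integrable_mult_left) (simp add: emeasure_eq_measure integrable_indicator_iff)
  show "integrable M (\<lambda>u. f (T u))"
    using int by (subst Bochner_Integration.integrable_cong[OF refl eq]) auto
  show "(\<integral>u. f (T u) \<partial>M) = (\<Sum>x\<in>\<Omega>. measure M {u \<in> space M. T u = x} * f x)"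
    using int T' by (subst Bochner_Integration.integral_cong[OF refl eq]) (auto intro!: sum.cong)
qed

text \<open>Shannon entropy, in bits, of the law of \<open>T\<close>. The set
  \<open>\<Omega>\<close> may exceed the set of attained values, since a value of probability 0
  contributes nothing.\<close>

definition finite_entropy :: "'u measure \<Rightarrow> 'x set \<Rightarrow> ('u \<Rightarrow> 'x) \<Rightarrow> real" where
  "finite_entropy M \<Omega> T = - (\<Sum>x\<in>\<Omega>. measure M {u \<in> space M. T u = x} * log 2 (measure M {u \<in> space M. T u = x}))"

context prob_space
begin

text \<open>Let p be the joint mass and r the product of the marginal masses. The sum of p log r is
  minus the sum of the marginal entropies whatever the dependence, so Gibbs gives the inequality,
  and p = r turns it into an equality.\<close>

lemma
  fixes X :: "'i \<Rightarrow> 'a \<Rightarrow> 'x"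
  assumes "finite J" "finite V"
    and X: "\<And>n. n \<in> J \<Longrightarrow> X n \<in> M \<rightarrow>\<^sub>M count_space V"
    and T: "T \<in> M \<rightarrow>\<^sub>M count_space (Pi\<^sub>E J (\<lambda>_. V))"
    and TX: "\<And>u n. u \<in> space M \<Longrightarrow> n \<in> J \<Longrightarrow> T u n = X n u"
  shows finite_entropy_subadditive:
      "finite_entropy M (Pi\<^sub>E J (\<lambda>_. V)) T \<le> (\<Sum>n\<in>J. finite_entropy M V (X n))" (is ?le)
    and finite_entropy_additive:
      "(\<And>x. x \<in> Pi\<^sub>E J (\<lambda>_. V) \<Longrightarrow>
         prob {u \<in> space M. T u = x} = (\<Prod>n\<in>J. prob {u \<in> space M. X n u = x n})) \<Longrightarrow>
       finite_entropy M (Pi\<^sub>E J (\<lambda>_. V)) T = (\<Sum>n\<in>J. finite_entropy M V (X n))"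
proof -
  let ?\<Omega> = "Pi\<^sub>E J (\<lambda>_. V)"
  define p where "p x = prob {u \<in> space M. T u = x}" for x
  define q where "q n j = prob {u \<in> space M. X n u = j}" for n j
  define r where "r x = (\<Prod>n\<in>J. q n (x n))" for x
  have fin: "finite ?\<Omega>" using assms by (intro finite_PiE) auto
  have sumq: "(\<Sum>j\<in>V. q n j) = 1" if "n \<in> J" for n
    using integral_finite_valued(1)[OF X[OF that] \<open>finite V\<close>, of "\<lambda>_. 1"] by (simp add: q_def prob_space)
  have sump: "(\<Sum>x\<in>?\<Omega>. p x) = 1"
    using integral_finite_valued(1)[OF T fin, of "\<lambda>_. 1"] by (simp add: p_def prob_space)
  have sumr: "(\<Sum>x\<in>?\<Omega>. r x) = 1"
  proof -
    have "(\<Sum>x\<in>?\<Omega>. r x) = (\<Prod>n\<in>J. \<Sum>j\<in>V. q n j)"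
      unfolding r_def using assms by (subst prod_sum_PiE) auto
    then show ?thesis using sumq by simp
  qed
  \<comment> \<open>An atom of positive joint mass has positive marginals. This lets the logarithm
    of the product split and gives the absolute continuity that Gibbs requires.\<close>
  have pq: "p x \<le> q n (x n)" if "x \<in> ?\<Omega>" "n \<in> J" for x n
    unfolding p_def q_def
  proof (intro finite_measure_mono)
    have "X n -` {x n} \<inter> space M \<in> events" 
      using that by (intro measurable_sets[OF X]) auto
    then show "{u \<in> space M. X n u = x n} \<in> events" by (simp add: vimage_def Int_def conj_commute)
  qed (use TX that in auto)
  have p0: "0 \<le> p x" and q0: "0 \<le> q n j" for x n j by (simp_all add: p_def q_def)
  have "(\<Sum>x\<in>?\<Omega>. p x * log 2 (r x)) = (\<Sum>x\<in>?\<Omega>. \<Sum>n\<in>J. p x * log 2 (q n (x n)))"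
  proof (intro sum.cong refl)
    fix x assume x: "x \<in> ?\<Omega>"
    show "p x * log 2 (r x) = (\<Sum>n\<in>J. p x * log 2 (q n (x n)))"
    proof (cases "p x = 0")
      case False
      then have "q n (x n) \<noteq> 0" if "n \<in> J" for n
        using pq[OF x that] p0[of x] by auto
      then show ?thesis
        unfolding r_def log_def using q0
        by (subst ln_prod) (auto simp: \<open>finite J\<close> less_le sum_divide_distrib sum_distrib_left)
    qed simp
  qed
  also have "\<dots> = (\<Sum>n\<in>J. \<Sum>x\<in>?\<Omega>. p x * log 2 (q n (x n)))"
    by (rule sum.swap)
  also have "\<dots> = (\<Sum>n\<in>J. \<Sum>j\<in>V. q n j * log 2 (q n j))"
  proof (intro sum.cong refl)
    fix n assume n: "n \<in> J"
    \<comment> \<open>The other coordinates are summed out by reading both sums as the expectation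
      of the same function of \<open>X n\<close>.\<close>
    have "(\<Sum>x\<in>?\<Omega>. p x * log 2 (q n (x n))) = (\<integral>u. log 2 (q n (T u n)) \<partial>M)"
      unfolding p_def using integral_finite_valued(1)[OF T fin, of "\<lambda>x. log 2 (q n (x n))"] by simp
    also have "\<dots> = (\<integral>u. log 2 (q n (X n u)) \<partial>M)"
      using TX n by (intro Bochner_Integration.integral_cong) auto
    also have "\<dots> = (\<Sum>j\<in>V. q n j * log 2 (q n j))"
      using integral_finite_valued(1)[OF X[OF n] \<open>finite V\<close>, of "\<lambda>j. log 2 (q n j)"] by (simp add: q_def)
    finally show "(\<Sum>x\<in>?\<Omega>. p x * log 2 (q n (x n))) = (\<Sum>j\<in>V. q n j * log 2 (q n j))" .
  qed
  finally have pr: "(\<Sum>x\<in>?\<Omega>. p x * log 2 (r x)) = - (\<Sum>n\<in>J. finite_entropy M V (X n))"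
    by (simp add: finite_entropy_def q_def sum_negf)
  have "(\<Sum>x\<in>?\<Omega>. p x * log 2 (r x)) \<le> (\<Sum>x\<in>?\<Omega>. p x * log 2 (p x))"
  proof (rule gibbs_inequality)
    fix x assume x: "x \<in> ?\<Omega>" "0 < p x"
    then show "0 < r x"
      unfolding r_def using pq by (intro prod_pos) (auto intro: less_le_trans)
  qed (auto simp: p0 q0 r_def[symmetric] sump sumr, auto simp: r_def q0 intro!: prod_nonneg)
  then show ?le
    unfolding pr by (simp add: finite_entropy_def p_def)
  show "finite_entropy M ?\<Omega> T = (\<Sum>n\<in>J. finite_entropy M V (X n))"
    if "\<And>x. x \<in> ?\<Omega> \<Longrightarrow> prob {u \<in> space M. T u = x} = (\<Prod>n\<in>J. prob {u \<in> space M. X n u = x n})"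
  proof -
    have "(\<Sum>x\<in>?\<Omega>. p x * log 2 (r x)) = (\<Sum>x\<in>?\<Omega>. p x * log 2 (p x))"
      using that by (intro sum.cong) (simp_all add: p_def r_def q_def)
    then show ?thesis unfolding pr by (simp add: finite_entropy_def p_def)
  qed
qed

end

section \<open>The dyadic questions\<close>

text \<open>Think of \<open>E p\<close> as the event U <= p for a uniform variable U. Then
  \<open>A n\<close> says that the n-th binary digit of U is 1, and the digits are independent fair
  bits.\<close>

lemma (in prob_space) dyadic_halving_indep:
  fixes E :: "real \<Rightarrow> 'a set" and A :: "nat \<Rightarrow> 'a set"
  defines "A \<equiv> \<lambda>n. \<Union>j\<in>{1..2 ^ (n - 1)}. E (2 * real j / 2 ^ n) - E ((2 * real j - 1) / 2 ^ n)"
  assumes E: "\<And>p. 0 \<le> p \<Longrightarrow> p \<le> 1 \<Longrightarrow> E p \<in> events"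
    and mono: "\<And>p q. 0 \<le> p \<Longrightarrow> p \<le> q \<Longrightarrow> q \<le> 1 \<Longrightarrow> E p \<subseteq> E q"
    and prob: "\<And>p. 0 \<le> p \<Longrightarrow> p \<le> 1 \<Longrightarrow> prob (E p) = p"
    and "E 0 = {}"
    and J: "J \<subseteq> {1..N}"
  shows "prob (E 1 \<inter> (\<Inter>n\<in>J. A n)) = (1 / 2) ^ card J"
proof -
  \<comment> \<open>The dyadic cells of level \<open>N\<close>: \<open>D N m\<close> is the event
    that U lies between m/2^N (excluded) and (m + 1)/2^N.\<close>
  define D where "D N m = E ((real m + 1) / 2 ^ N) - E (real m / 2 ^ N)" for N m :: nat
  have range: "0 \<le> real m / 2 ^ N" "real m / 2 ^ N \<le> (real m + 1) / 2 ^ N" "(real m + 1) / 2 ^ N \<le> 1"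
    if "m < 2 ^ N" for m N :: nat
  proof -
    have "real m + 1 \<le> 2 ^ N" using that by (metis Suc_leI of_nat_Suc of_nat_le_iff of_nat_numeral of_nat_power add.commute)
    then show "(real m + 1) / 2 ^ N \<le> 1" by simp
  qed (auto simp: divide_right_mono)
  have D_events: "D N m \<in> events" and D_prob: "prob (D N m) = 1 / 2 ^ N" if "m < 2 ^ N" for N m
  proof -
    note r = range[OF that]
    show "D N m \<in> events" unfolding D_def using r by (intro sets.Diff E) linarith+
    have "prob (D N m) = prob (E ((real m + 1) / 2 ^ N)) - prob (E (real m / 2 ^ N))"
      unfolding D_def using r by (intro finite_measure_Diff E mono) linarith+
    also have "prob (E ((real m + 1) / 2 ^ N)) = (real m + 1) / 2 ^ N"
      using r by (intro prob) linarith+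
    also have "prob (E (real m / 2 ^ N)) = real m / 2 ^ N"
      using r by (intro prob) linarith+
    also have "(real m + 1) / 2 ^ N - real m / 2 ^ N = 1 / 2 ^ N"
      by (simp add: add_divide_distrib)
    finally show "prob (D N m) = 1 / 2 ^ N" .
  qed
  have D_less_disjoint: "D N m \<inter> D N m' = {}" if "m < m'" "m' < 2 ^ N" for N m m'
  proof -
    have "(real m + 1) / 2 ^ N \<le> real m' / 2 ^ N" using that by (intro divide_right_mono) auto
    moreover note range[of m N] range[of m' N]
    ultimately have "E ((real m + 1) / 2 ^ N) \<subseteq> E (real m' / 2 ^ N)"
      using that by (intro mono) auto
    then show ?thesis by (auto simp: D_def)
  qed
  have D_disjoint: "D N m \<inter> D N m' = {}" if "m \<noteq> m'" "m < 2 ^ N" "m' < 2 ^ N" for N m m'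
    using D_less_disjoint[of m m' N] D_less_disjoint[of m' m N] that by (cases m m' rule: linorder_cases) auto
  have D_split: "D N m = D (Suc N) (2 * m) \<union> D (Suc N) (2 * m + 1)" if "m < 2 ^ N" for N m
  proof -
    have eqs: "real (2 * m) / 2 ^ Suc N = real m / 2 ^ N" "(real (2 * m + 1) + 1) / 2 ^ Suc N = (real m + 1) / 2 ^ N"
      "real (2 * m + 1) / 2 ^ Suc N = (real (2 * m) + 1) / 2 ^ Suc N"
      by (simp_all add: field_simps)
    have "E (real m / 2 ^ N) \<subseteq> E ((real (2 * m) + 1) / 2 ^ Suc N)"
      using range[of "2 * m" "Suc N"] range[of m N] that unfolding eqs(1)[symmetric] by (intro mono) auto
    moreover have "E ((real (2 * m) + 1) / 2 ^ Suc N) \<subseteq> E ((real m + 1) / 2 ^ N)"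
      using range[of "2 * m + 1" "Suc N"] range[of m N] that unfolding eqs(2)[symmetric] eqs(3)[symmetric] by (intro mono) auto
    ultimately show ?thesis
      unfolding D_def eqs by blast
  qed
  \<comment> \<open>With j = m + 1, the j-th piece of \<open>A (Suc N)\<close> is the cell of odd
    index 2m + 1, the upper half of the cell m of level \<open>N\<close>.\<close>
  have A_eq: "A (Suc N) = (\<Union>m<2 ^ N. D (Suc N) (2 * m + 1))" for N
  proof -
    have "A (Suc N) = (\<Union>j\<in>Suc ` {..<2 ^ N}. E (2 * real j / 2 ^ Suc N) - E ((2 * real j - 1) / 2 ^ Suc N))"
      by (simp only: A_def diff_Suc_1 image_Suc_lessThan)
    moreover have "real (2 * m + 1) + 1 = 2 * real (Suc m)" "real (2 * m + 1) = 2 * real (Suc m) - 1" for m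
      by simp_all
    ultimately show ?thesis unfolding D_def by (simp only: UN_simps image_image)
  qed
  have D_A: "D N m \<inter> A (Suc N) = D (Suc N) (2 * m + 1)" if "m < 2 ^ N" for N m
  proof -
    have "D N m \<inter> D (Suc N) (2 * m' + 1) = {}" if "m' < 2 ^ N" "m' \<noteq> m" for m'
      using D_disjoint[of m m' N] D_split[of m' N] that \<open>m < 2 ^ N\<close> by blast
    then show ?thesis
      unfolding A_eq using that D_split[OF that] by blast
  qed
  \<comment> \<open>Intersecting a union of cells of level \<open>N\<close> with \<open>A (N + 1)\<close> keeps the odd half of each cell.\<close>
  have "\<exists>K\<subseteq>{..<2 ^ N}. card K * 2 ^ card J = 2 ^ N \<and> E 1 \<inter> (\<Inter>n\<in>J. A n) = (\<Union>m\<in>K. D N m)"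
    if "J \<subseteq> {1..N}" for J N
    using that
  proof (induction N arbitrary: J)
    case 0
    then have "J = {}" by auto
    \<comment> \<open>The only cell of level 0 is \<open>E 1 - E 0\<close>, which is
      \<open>E 1\<close>.\<close>
    then show ?case by (intro exI[of _ "{0}"]) (auto simp: D_def \<open>E 0 = {}\<close>)
  next
    case (Suc N)
    define J' where "J' = J - {Suc N}"
    have "J' \<subseteq> {1..N}" using Suc.prems by (auto simp: J'_def le_Suc_eq)
    from Suc.IH[OF this] obtain K where K: "K \<subseteq> {..<2 ^ N}" "card K * 2 ^ card J' = 2 ^ N"
      and K_eq: "E 1 \<inter> (\<Inter>n\<in>J'. A n) = (\<Union>m\<in>K. D N m)" by blast
    have finK: "finite K" using K(1) finite_subset by blast
    let ?odd = "(\<lambda>m. 2 * m + 1) ` K" and ?even = "(\<lambda>m. 2 * m) ` K"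
    have odd: "?odd \<subseteq> {..<2 ^ Suc N}" "card ?odd = card K" using K(1) by (auto simp: card_image inj_on_def)
    have even: "?even \<subseteq> {..<2 ^ Suc N}" "card ?even = card K" using K(1) by (auto simp: card_image inj_on_def)
    have finJ: "finite J" using Suc.prems finite_subset by blast
    show ?case
    proof (cases "Suc N \<in> J")
      case True
      then have J: "J = insert (Suc N) J'" "Suc N \<notin> J'" "finite J'" using finJ by (auto simp: J'_def)
      have "E 1 \<inter> (\<Inter>n\<in>J. A n) = (E 1 \<inter> (\<Inter>n\<in>J'. A n)) \<inter> A (Suc N)" by (auto simp: J)
      also have "\<dots> = (\<Union>m\<in>K. D N m \<inter> A (Suc N))" unfolding K_eq by (auto simp: J)
      also have "(\<Union>m\<in>K. D N m \<inter> A (Suc N)) = (\<Union>m\<in>?odd. D (Suc N) m)"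
      proof -
        have "(\<Union>m\<in>K. D N m \<inter> A (Suc N)) = (\<Union>m\<in>K. D (Suc N) (2 * m + 1))"
          using K(1) by (intro SUP_cong refl D_A) auto
        then show ?thesis by (simp only: image_image)
      qed
      finally show ?thesis
        using odd K(2) J by (intro exI[of _ ?odd]) (simp add: mult_ac)
    next
      \<comment> \<open>Both halves of every cell survive, so the number of cells doubles together
        with the power of 2.\<close>
      case False
      then have J: "J' = J" by (auto simp: J'_def)
      have "(\<Union>m\<in>K. D N m) = (\<Union>m\<in>?odd \<union> ?even. D (Suc N) m)"
      proof -
        have "(\<Union>m\<in>K. D N m) = (\<Union>m\<in>K. D (Suc N) (2 * m) \<union> D (Suc N) (2 * m + 1))"
          using K(1) by (intro SUP_cong refl D_split) auto
        then show ?thesis by blast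
      qed
      moreover have "card (?odd \<union> ?even) = card K + card K"
        using odd(2) even(2) finK by (subst card_Un_disjoint) (auto, presburger)
      ultimately show ?thesis
        using odd even K(2) K_eq unfolding J by (intro exI[of _ "?odd \<union> ?even"]) (simp add: algebra_simps)
    qed
  qed
  from this[OF J] obtain K where K: "K \<subseteq> {..<2 ^ N}" "card K * 2 ^ card J = 2 ^ N"
    and K_eq: "E 1 \<inter> (\<Inter>n\<in>J. A n) = (\<Union>m\<in>K. D N m)" by blast
  have "finite K" using K(1) finite_subset by blast
  have "prob (\<Union>m\<in>K. D N m) = (\<Sum>m\<in>K. prob (D N m))"
    using K(1) \<open>finite K\<close> D_events D_disjoint
    by (intro finite_measure_finite_Union) (auto simp: disjoint_family_on_def, blast)
  also have "\<dots> = (\<Sum>m\<in>K. 1 / 2 ^ N)"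
    using K(1) D_prob by (intro sum.cong) auto
  also have "\<dots> = (1 / 2) ^ card J"
    using arg_cong[OF K(2), of real] by (simp add: field_simps)
  finally show ?thesis unfolding K_eq .
qed

section \<open>Quantiles of a law with a density\<close>

context
  fixes f0 :: "real \<Rightarrow> real" and \<mu> :: "real measure"
  defines "\<mu> \<equiv> density lborel (\<lambda>x. ennreal (f0 x))"
  assumes f0 [measurable]: "f0 \<in> borel_measurable borel" and f0_nonneg: "\<And>x. 0 \<le> f0 x"
    and prob_\<mu>: "prob_space \<mu>"
begin

lemma real_distribution_density: "real_distribution \<mu>"
  using prob_\<mu> by (auto simp: real_distribution_def real_distribution_axioms_def \<mu>_def)

text \<open>A law with a density has no atoms.\<close>

lemma isCont_cdf_density: "isCont (cdf \<mu>) x"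
proof -
  interpret real_distribution \<mu> by (rule real_distribution_density)
  have "emeasure \<mu> {x} = 0"
    unfolding \<mu>_def using AE_lborel_singleton[of x]
    by (subst emeasure_density) (auto simp: nn_integral_0_iff_AE indicator_def elim: eventually_mono)
  then show ?thesis by (simp add: isCont_cdf measure_def)
qed

text \<open>For a finite quantile this is F(Q(p)) = p, which rests on continuity of F. The quantile
  is minus infinity at p = 0; it can be plus infinity only at p = 1. In these cases the event is
  empty or the whole line.\<close>

lemma measure_le_quantile:
  assumes "0 \<le> p" "p \<le> 1"
  shows "measure \<mu> {t. ereal t \<le> quantile f0 p} = p"
proof -
  interpret real_distribution \<mu> by (rule real_distribution_density)
  let ?F = "cdf \<mu>"
  define S where "S = {u. p \<le> ?F u}"
  have Q: "quantile f0 p = Inf (ereal ` S)"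
    by (simp add: quantile_def S_def \<mu>_def image_Collect)
  consider "p = 0" | "0 < p" "S = {}" | "0 < p" "S \<noteq> {}" using assms by fastforce
  then show ?thesis
  proof cases
    case 1
    then have "quantile f0 p \<le> ereal u" for u
      unfolding Q by (intro Inf_lower) (auto simp: S_def cdf_nonneg)
    then have "\<not> ereal t \<le> quantile f0 p" for t
      using order_trans[of "ereal t" "quantile f0 p" "ereal (t - 1)"] by auto
    then show ?thesis using 1 by simp
  next
    case 2
    \<comment> \<open>If \<open>S\<close> is empty, F stays below p, so p is at least the limit 1 of
      F at infinity.\<close>
    have "1 \<le> p"
      by (rule tendsto_upperbound[OF cdf_lim_at_top_prob])
         (use 2 in \<open>auto simp: S_def not_le intro!: always_eventually less_imp_le\<close>)
    moreover have "quantile f0 p = \<infinity>" unfolding Q using 2 by (simp add: top_ereal_def)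
    ultimately show ?thesis using assms prob_space by simp
  next
    case 3
    have "closed S"
      unfolding S_def using isCont_cdf_density
      by (intro closed_Collect_le continuous_on_const continuous_at_imp_continuous_on) auto
    moreover have bdd: "bdd_below S"
    proof -
      have "eventually (\<lambda>u. ?F u < p) at_bot"
        using order_tendstoD(2)[OF cdf_lim_at_bot \<open>0 < p\<close>] .
      then obtain b where "\<And>u. u \<le> b \<Longrightarrow> ?F u < p" by (auto simp: eventually_at_bot_linorder)
      then have "b \<le> u" if "u \<in> S" for u
        using that by (metis S_def linear mem_Collect_eq not_le)
      then show ?thesis by (rule bdd_belowI)
    qed
    ultimately have "Inf S \<in> S" using 3 by (intro closed_contains_Inf)
    then have "quantile f0 p = ereal (Inf S)"
      unfolding Q using bdd by (intro antisym Inf_lower Inf_greatest) (auto intro: cInf_lower)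
    \<comment> \<open>Points to the left of \<open>Inf S\<close> are not in \<open>S\<close>, so F
      is below p there, and the bound passes to the limit by continuity.\<close>
    moreover have "?F (Inf S) \<le> p"
    proof (rule tendsto_upperbound)
      show "(?F \<longlongrightarrow> ?F (Inf S)) (at_left (Inf S))"
        using isCont_cdf_density[of "Inf S"] by (simp add: isCont_def filterlim_at_split)
      have "?F u \<le> p" if "u < Inf S" for u
        using that bdd cInf_lower[of u S] by (metis S_def linear mem_Collect_eq not_le)
      then show "\<forall>\<^sub>F u in at_left (Inf S). ?F u \<le> p"
        by (auto simp: eventually_at_filter)
    qed simp
    ultimately show ?thesis
      using \<open>Inf S \<in> S\<close> by (simp add: S_def cdf_def atMost_def)
  qed
qed

lemma dyadic_question_measurable: "dyadic_question f0 n \<in> sets borel"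
  unfolding dyadic_question_def by measurable

lemma quantile_mono: "p \<le> q \<Longrightarrow> quantile f0 p \<le> quantile f0 q"
  unfolding quantile_def by (intro Inf_superset_mono) auto

text \<open>The halving lemma applied to the half-lines below the quantiles. Restricting to the
  support of \<open>f0\<close> and to \<open>E 1\<close> changes the events by null sets
  only.\<close>

lemma dyadic_questions_indep:
  assumes J: "J \<subseteq> {1..N}"
  shows "measure \<mu> (space \<mu> \<inter> (\<Inter>n\<in>J. dyadic_question f0 n)) = (\<Prod>n\<in>J. 1 / 2)"
proof -
  interpret real_distribution \<mu> by (rule real_distribution_density)
  define E where "E p = {t. ereal t \<le> quantile f0 p}" for p
  define A where "A n = (\<Union>j\<in>{1..2 ^ (n - 1)}. E (2 * real j / 2 ^ n) - E ((2 * real j - 1) / 2 ^ n))" for n :: nat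
  have E: "E p \<in> sets borel" for p unfolding E_def by measurable
  then have A: "A n \<in> sets borel" for n unfolding A_def by (intro sets.finite_UN sets.Diff) auto
  have E_prob: "measure \<mu> (E p) = p" if "0 \<le> p" "p \<le> 1" for p
    unfolding E_def using that by (rule measure_le_quantile)
  have E0: "E 0 = {}"
  proof -
    have "quantile f0 0 \<le> ereal u" for u
      unfolding quantile_def by (intro Inf_lower) (auto simp: \<mu>_def[symmetric] cdf_nonneg)
    then have "\<not> ereal t \<le> quantile f0 0" for t
      using order_trans[of "ereal t" "quantile f0 0" "ereal (t - 1)"] by auto
    then show ?thesis by (simp add: E_def)
  qed
  have "AE t in \<mu>. t \<in> E 1"
    using E_prob[of 1] E by (intro AE_prob_1) auto
  moreover have "AE t in \<mu>. 0 < f0 t"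
    unfolding \<mu>_def by (subst AE_density) (auto simp: ennreal_less_zero_iff)
  ultimately have "measure \<mu> (space \<mu> \<inter> (\<Inter>n\<in>J. dyadic_question f0 n)) = measure \<mu> (E 1 \<inter> (\<Inter>n\<in>J. A n))"
  proof (intro finite_measure_eq_AE)
    show "AE t in \<mu>. (t \<in> space \<mu> \<inter> (\<Inter>n\<in>J. dyadic_question f0 n)) = (t \<in> E 1 \<inter> (\<Inter>n\<in>J. A n))"
      if "AE t in \<mu>. t \<in> E 1" "AE t in \<mu>. 0 < f0 t"
      using that
    proof eventually_elim
      case (elim t)
      then show ?case by (simp add: dyadic_question_def A_def E_def not_le conj_commute)
    qed
    have "finite J" using J finite_subset by blast
    then show "space \<mu> \<inter> (\<Inter>n\<in>J. dyadic_question f0 n) \<in> events" "E 1 \<inter> (\<Inter>n\<in>J. A n) \<in> events"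
      using dyadic_question_measurable A E
      by (cases "J = {}"; auto intro!: sets.Int sets.finite_INT)+
  qed
  also have "\<dots> = (1 / 2) ^ card J"
    unfolding A_def
  proof (rule dyadic_halving_indep)
    show "E p \<subseteq> E q" if "p \<le> q" for p q
      using quantile_mono[OF that] by (auto simp: E_def)
  qed (use E E_prob E0 J in auto)
  finally show ?thesis by simp
qed

end

section \<open>The law of the answers to fixed questions\<close>

text \<open>A function of an indicator is affine in it. Expanding the product over subsets S
  therefore involves only intersections of the \<open>A n\<close>, so the product formula for these
  suffices and complements never appear.\<close>

lemma (in prob_space) expectation_prod_indicator:
  fixes A :: "'n \<Rightarrow> 'a set" and h :: "'n \<Rightarrow> nat \<Rightarrow> real"
  assumes "finite J" and A: "\<And>n. n \<in> J \<Longrightarrow> A n \<in> events"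
    and indep: "\<And>S. S \<subseteq> J \<Longrightarrow> prob (space M \<inter> (\<Inter>n\<in>S. A n)) = (\<Prod>n\<in>S. q n)"
  shows "(\<integral>t. (\<Prod>n\<in>J. h n (indicator (A n) t)) \<partial>M) = (\<Prod>n\<in>J. (1 - q n) * h n 0 + q n * h n 1)"
proof -
  have ev: "space M \<inter> (\<Inter>n\<in>S. A n) \<in> events" if "S \<subseteq> J" for S
    using that \<open>finite J\<close> A finite_subset[OF that]
    by (cases "S = {}") (auto intro!: sets.Int sets.finite_INT)
  have "(\<integral>t. (\<Prod>n\<in>J. h n (indicator (A n) t)) \<partial>M) =
      (\<integral>t. (\<Sum>S\<in>Pow J. indicator (space M \<inter> (\<Inter>n\<in>S. A n)) t *
         ((\<Prod>n\<in>S. h n 1 - h n 0) * (\<Prod>n\<in>J - S. h n 0))) \<partial>M)"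
  proof (intro Bochner_Integration.integral_cong refl)
    fix t assume t: "t \<in> space M"
    have "(\<Prod>n\<in>J. h n (indicator (A n) t)) = (\<Prod>n\<in>J. indicator (A n) t * (h n 1 - h n 0) + h n 0)"
      by (intro prod.cong) (auto simp: indicator_def)
    also have "\<dots> = (\<Sum>S\<in>Pow J. (\<Prod>n\<in>S. indicator (A n) t * (h n 1 - h n 0)) * (\<Prod>n\<in>J - S. h n 0))"
      by (rule prod_add[OF \<open>finite J\<close>])
    also have "\<dots> = (\<Sum>S\<in>Pow J. indicator (space M \<inter> (\<Inter>n\<in>S. A n)) t *
         ((\<Prod>n\<in>S. h n 1 - h n 0) * (\<Prod>n\<in>J - S. h n 0)))"
    proof (intro sum.cong refl)
      fix S assume "S \<in> Pow J"
      then have "finite S" using \<open>finite J\<close> finite_subset by auto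
      then have "(\<Prod>n\<in>S. indicator (A n) t) = (indicator (space M \<inter> (\<Inter>n\<in>S. A n)) t :: real)"
        using t by (induction S) (auto simp: indicator_def)
      then show "(\<Prod>n\<in>S. indicator (A n) t * (h n 1 - h n 0)) * (\<Prod>n\<in>J - S. h n 0) =
        indicator (space M \<inter> (\<Inter>n\<in>S. A n)) t * ((\<Prod>n\<in>S. h n 1 - h n 0) * (\<Prod>n\<in>J - S. h n 0))"
        by (simp add: prod.distrib)
    qed
    finally show "(\<Prod>n\<in>J. h n (indicator (A n) t)) = \<dots>" .
  qed
  also have "\<dots> = (\<Sum>S\<in>Pow J. prob (space M \<inter> (\<Inter>n\<in>S. A n)) * ((\<Prod>n\<in>S. h n 1 - h n 0) * (\<Prod>n\<in>J - S. h n 0)))"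
    using ev by (subst Bochner_Integration.integral_sum)
      (auto intro!: sum.cong integrable_mult_left simp: integrable_indicator_iff emeasure_eq_measure Int_assoc[symmetric])
  also have "\<dots> = (\<Sum>S\<in>Pow J. (\<Prod>n\<in>S. q n * (h n 1 - h n 0)) * (\<Prod>n\<in>J - S. h n 0))"
    using indep by (intro sum.cong) (auto simp: prod.distrib)
  also have "\<dots> = (\<Prod>n\<in>J. q n * (h n 1 - h n 0) + h n 0)"
    by (rule prod_add[OF \<open>finite J\<close>, symmetric])
  finally show ?thesis by (simp add: algebra_simps)
qed

text \<open>On the naturals the discrete and the Borel sigma-algebra coincide, so measurability of
  sums carries over.\<close>

lemma measurable_count_space_sum_nat:
  fixes f :: "'i \<Rightarrow> 'a \<Rightarrow> nat"
  assumes "\<And>i. i \<in> I \<Longrightarrow> f i \<in> M \<rightarrow>\<^sub>M count_space UNIV"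
  shows "(\<lambda>u. \<Sum>i\<in>I. f i u) \<in> M \<rightarrow>\<^sub>M count_space UNIV"
proof -
  have "sets (count_space UNIV :: nat measure) = sets borel"
    by (simp add: sets_borel_eq_count_space)
  note eq = measurable_cong_sets[OF refl this]
  show ?thesis
    using assms unfolding eq by (rule borel_measurable_sum)
qed

text \<open>The counts are independent binomials. Integrating out one coordinate replaces each
  \<open>g n\<close> by its average over one trial, and \<open>binom_mean_Suc\<close> absorbs this;
  hence the induction over \<open>I\<close> with \<open>g\<close> arbitrary.\<close>

lemma expectation_prod_counts:
  fixes A :: "'n \<Rightarrow> 'b set" and g :: "'n \<Rightarrow> nat \<Rightarrow> real"
  assumes "prob_space \<mu>" "finite I" "finite J" and A: "\<And>n. n \<in> J \<Longrightarrow> A n \<in> sets \<mu>"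
    and indep: "\<And>S. S \<subseteq> J \<Longrightarrow> measure \<mu> (space \<mu> \<inter> (\<Inter>n\<in>S. A n)) = (\<Prod>n\<in>S. q n)"
  shows "(\<integral>u. (\<Prod>n\<in>J. g n (\<Sum>i\<in>I. indicator (A n) (u i))) \<partial>Pi\<^sub>M I (\<lambda>_. \<mu>)) =
    (\<Prod>n\<in>J. binom_mean (card I) (q n) (g n))"
  using \<open>finite I\<close>
proof (induction I arbitrary: g)
  case empty
  interpret P: prob_space "Pi\<^sub>M {} (\<lambda>_. \<mu>)" by (intro prob_space_PiM \<open>prob_space \<mu>\<close>)
  show ?case by (simp add: P.prob_space)
next
  case (insert i I)
  interpret \<mu>: prob_space \<mu> by fact
  interpret product_sigma_finite "\<lambda>_. \<mu>" ..
  interpret P: prob_space "Pi\<^sub>M (insert i I) (\<lambda>_. \<mu>)" by (intro prob_space_PiM \<open>prob_space \<mu>\<close>)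
  let ?c = "\<lambda>n x. \<Sum>l\<in>I. indicator (A n) (x l) :: nat"
  let ?g = "\<lambda>n c. (1 - q n) * g n c + q n * g n (Suc c)"
  have int: "integrable (Pi\<^sub>M (insert i I) (\<lambda>_. \<mu>)) (\<lambda>u. \<Prod>n\<in>J. g n (\<Sum>i\<in>insert i I. indicator (A n) (u i)))"
  proof (rule P.integrable_const_bound)
    \<comment> \<open>A count is at most the number of coordinates, so \<open>g n\<close> is
      evaluated at finitely many points and the sum of its absolute values there is a bound.\<close>
    let ?b = "\<lambda>n. \<Sum>c\<le>card (insert i I). \<bar>g n c\<bar>"
    show "AE u in Pi\<^sub>M (insert i I) (\<lambda>_. \<mu>).
        norm (\<Prod>n\<in>J. g n (\<Sum>i\<in>insert i I. indicator (A n) (u i))) \<le> (\<Prod>n\<in>J. ?b n)"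
    proof (intro AE_I2)
      fix u
      have "\<bar>g n (\<Sum>i\<in>insert i I. indicator (A n) (u i))\<bar> \<le> ?b n" for n
      proof (rule member_le_sum)
        show "(\<Sum>i\<in>insert i I. indicator (A n) (u i)) \<in> {..card (insert i I)}"
          using sum_mono[of "insert i I" "\<lambda>i. indicator (A n) (u i)" "\<lambda>_. 1 :: nat"]
          by (simp add: indicator_def)
      qed auto
      then show "norm (\<Prod>n\<in>J. g n (\<Sum>i\<in>insert i I. indicator (A n) (u i))) \<le> (\<Prod>n\<in>J. ?b n)"
        by (auto simp: abs_prod intro!: prod_mono)
    qed
    have "(\<lambda>u. g n (\<Sum>i\<in>insert i I. indicator (A n) (u i))) \<in> borel_measurable (Pi\<^sub>M (insert i I) (\<lambda>_. \<mu>))"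
      if "n \<in> J" for n
    proof -
      note A[OF that, measurable]
      have "(\<lambda>u. \<Sum>i\<in>insert i I. indicator (A n) (u i) :: nat) \<in> Pi\<^sub>M (insert i I) (\<lambda>_. \<mu>) \<rightarrow>\<^sub>M count_space UNIV"
        unfolding indicator_def by (intro measurable_count_space_sum_nat) measurable
      then show ?thesis by measurable
    qed
    then show "(\<lambda>u. \<Prod>n\<in>J. g n (\<Sum>i\<in>insert i I. indicator (A n) (u i)))
        \<in> borel_measurable (Pi\<^sub>M (insert i I) (\<lambda>_. \<mu>))"
      by (intro borel_measurable_prod)
  qed
  have "(\<integral>u. (\<Prod>n\<in>J. g n (\<Sum>i\<in>insert i I. indicator (A n) (u i))) \<partial>Pi\<^sub>M (insert i I) (\<lambda>_. \<mu>)) =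
     (\<integral>x. (\<integral>y. (\<Prod>n\<in>J. g n (\<Sum>l\<in>insert i I. indicator (A n) ((x(i := y)) l))) \<partial>\<mu>) \<partial>Pi\<^sub>M I (\<lambda>_. \<mu>))"
    by (rule product_integral_insert[OF insert.hyps int])
  also have "\<dots> = (\<integral>x. (\<Prod>n\<in>J. ?g n (?c n x)) \<partial>Pi\<^sub>M I (\<lambda>_. \<mu>))"
  proof (intro Bochner_Integration.integral_cong refl)
    fix x
    have "(\<integral>y. (\<Prod>n\<in>J. g n (\<Sum>l\<in>insert i I. indicator (A n) ((x(i := y)) l))) \<partial>\<mu>) =
        (\<integral>y. (\<Prod>n\<in>J. (\<lambda>b. g n (b + ?c n x)) (indicator (A n) y)) \<partial>\<mu>)"
    proof (intro Bochner_Integration.integral_cong refl prod.cong)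
      fix y n
      have "(\<Sum>l\<in>I. indicator (A n) ((x(i := y)) l)) = ?c n x"
        using insert.hyps by (intro sum.cong) auto
      then show "g n (\<Sum>l\<in>insert i I. indicator (A n) ((x(i := y)) l)) = g n (indicator (A n) y + ?c n x)"
        using insert.hyps by simp
    qed
    also have "\<dots> = (\<Prod>n\<in>J. ?g n (?c n x))"
      using \<mu>.expectation_prod_indicator[OF \<open>finite J\<close> A indep, of "\<lambda>n b. g n (b + ?c n x)"] by simp
    finally show "(\<integral>y. (\<Prod>n\<in>J. g n (\<Sum>l\<in>insert i I. indicator (A n) ((x(i := y)) l))) \<partial>\<mu>) = \<dots>" .
  qed
  also have "\<dots> = (\<Prod>n\<in>J. binom_mean (card I) (q n) (?g n))"
    by (rule insert.IH)
  also have "\<dots> = (\<Prod>n\<in>J. binom_mean (card (insert i I)) (q n) (g n))"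
    using insert.hyps by (simp add: binom_mean_Suc binom_mean_add binom_mean_cmult)
  finally show ?case .
qed

section \<open>Histories and posterior entropy\<close>

declare One_nat_def [simp del]

text \<open>Because [0, 1] is Borel, measurability in the trace sigma-algebra gives measurability in
  the full product, and \<open>z\<close> may range over all reals from here on.\<close>

lemma policy_sets:
  assumes "\<pi> \<in> policies k N" "n \<in> {1..N}"
  shows "\<pi> n \<in> sets (borel \<Otimes>\<^sub>M (Pi\<^sub>M {1..<n} (\<lambda>_. count_space {0..k}) \<Otimes>\<^sub>M borel))"
proof -
  let ?X = "Pi\<^sub>M {1..<n} (\<lambda>_. count_space {0..k}) \<Otimes>\<^sub>M (borel :: real measure)"
  let ?B = "borel \<Otimes>\<^sub>M ?X"
  let ?\<Omega> = "{0..1 :: real} \<times> space ?X"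
  have \<pi>: "\<pi> n \<in> sets (restrict_space borel {0..1} \<Otimes>\<^sub>M ?X)"
    using assms by (auto simp: policies_def)
  have \<Omega>: "?\<Omega> \<in> sets ?B" by (intro pair_measureI) auto
  \<comment> \<open>The identity, written through its components so that each can be restricted
    separately; the preimage of \<open>\<pi> n\<close> is \<open>\<pi> n\<close> itself.\<close>
  have "(\<lambda>x. (fst x, snd x)) \<in> restrict_space ?B ?\<Omega> \<rightarrow>\<^sub>M restrict_space borel {0..1} \<Otimes>\<^sub>M ?X"
    by (intro measurable_Pair measurable_restrict_space2 measurable_restrict_space1 measurable_fst measurable_snd)
       (auto simp: space_restrict_space)
  from measurable_sets[OF this \<pi>]
  have "(\<lambda>x. (fst x, snd x)) -` \<pi> n \<inter> space (restrict_space ?B ?\<Omega>) \<in> sets (restrict_space ?B ?\<Omega>)" .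
  moreover have "(\<lambda>x. (fst x, snd x)) -` \<pi> n \<inter> space (restrict_space ?B ?\<Omega>) = \<pi> n"
    using sets.sets_into_space[OF \<pi>] by (auto simp: space_restrict_space space_pair_measure)
  ultimately show ?thesis
    using \<Omega> by (auto simp: sets_restrict_space_iff)
qed

lemma question_sets:
  assumes "\<pi> \<in> policies k N" "n \<in> {1..N}"
  shows "question k \<pi> z u n \<in> sets borel"
proof -
  have "Pair (history k \<pi> z u (n - 1)) -` (Pair z -` \<pi> n) \<in> sets borel"
    using policy_sets[OF assms] by (intro sets_Pair1)
  then show ?thesis by (simp add: question_def vimage_def)
qed

lemma answer_le: "answer k \<pi> z u n \<le> k"
  using sum_mono[of "{1..k}" "\<lambda>i. indicator (question k \<pi> z u n) (u i)" "\<lambda>_. 1 :: nat"]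
  by (simp add: answer_def indicator_def)

lemma measurable_count_space_bounded:
  assumes "f \<in> M \<rightarrow>\<^sub>M count_space UNIV" "\<And>x. x \<in> space M \<Longrightarrow> f x \<in> V"
  shows "f \<in> M \<rightarrow>\<^sub>M count_space V"
proof -
  have "f \<in> M \<rightarrow>\<^sub>M restrict_space (count_space UNIV) V"
    using assms by (intro measurable_restrict_space2) auto
  then show ?thesis by (simp add: restrict_count_space)
qed

abbreviation answers :: "nat \<Rightarrow> nat \<Rightarrow> (nat \<Rightarrow> nat) set" where
  "answers k N \<equiv> Pi\<^sub>E {1..N} (\<lambda>_. {0..k})"

lemma finite_answers: "finite (answers k N)"
  by (intro finite_PiE) auto

text \<open>Joint measurability in (z, u) is what Fubini needs later. The induction identifies the
  finite discrete space of answer tuples with the product sigma-algebra in which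
  \<open>\<pi> (Suc n)\<close> is measurable.\<close>

lemma measurable_history:
  assumes \<pi>: "\<pi> \<in> policies k N" and "n \<le> N"
  shows "(\<lambda>x. history k \<pi> (fst x) (snd x) n) \<in> borel \<Otimes>\<^sub>M lborel_pow k \<rightarrow>\<^sub>M count_space (answers k n)"
  using \<open>n \<le> N\<close>
proof (induction n)
  case 0
  then show ?case by simp
next
  case (Suc n)
  let ?M = "borel \<Otimes>\<^sub>M lborel_pow k"
  have PiM: "count_space (answers k m) = Pi\<^sub>M {1..m} (\<lambda>_. count_space {0..k})" for m
    by (simp add: count_space_PiM_finite)
  have hist [measurable]: "(\<lambda>x. history k \<pi> (fst x) (snd x) n) \<in> ?M \<rightarrow>\<^sub>M Pi\<^sub>M {1..n} (\<lambda>_. count_space {0..k})"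
    using Suc unfolding PiM by simp
  have \<pi>': "\<pi> (Suc n) \<in> sets (borel \<Otimes>\<^sub>M (Pi\<^sub>M {1..n} (\<lambda>_. count_space {0..k}) \<Otimes>\<^sub>M borel))"
    using policy_sets[OF \<pi>, of "Suc n"] Suc.prems by (simp add: atLeastLessThanSuc_atLeastAtMost)
  let ?h = "\<lambda>x. \<Sum>i=1..k. indicator {t. (fst x, history k \<pi> (fst x) (snd x) n, t) \<in> \<pi> (Suc n)} (snd x i) :: nat"
  have "?h \<in> ?M \<rightarrow>\<^sub>M count_space UNIV"
  proof (rule measurable_count_space_sum_nat)
    fix i assume i [measurable]: "i \<in> {1..k}"
    have "(\<lambda>x. (fst x, history k \<pi> (fst x) (snd x) n, snd x i)) \<in> ?M \<rightarrow>\<^sub>M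
        borel \<Otimes>\<^sub>M (Pi\<^sub>M {1..n} (\<lambda>_. count_space {0..k}) \<Otimes>\<^sub>M borel)"
      by measurable
    from measurable_sets[OF this \<pi>']
    have [measurable]: "Measurable.pred ?M (\<lambda>x. (fst x, history k \<pi> (fst x) (snd x) n, snd x i) \<in> \<pi> (Suc n))"
      by (simp add: pred_def vimage_def Int_def conj_commute)
    show "(\<lambda>x. indicator {t. (fst x, history k \<pi> (fst x) (snd x) n, t) \<in> \<pi> (Suc n)} (snd x i) :: nat)
        \<in> ?M \<rightarrow>\<^sub>M count_space UNIV"
      unfolding indicator_def mem_Collect_eq by measurable
  qed
  then have "?h \<in> ?M \<rightarrow>\<^sub>M count_space {0..k}"
  proof (rule measurable_count_space_bounded)
    fix x
    show "?h x \<in> {0..k}"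
      using answer_le[of k \<pi> "fst x" "snd x" "Suc n"] by (simp add: answer_def question_def)
  qed
  then show ?case
    unfolding PiM history.simps using hist
    by (intro measurable_fun_upd[of _ "{1..n}"]) auto
qed

lemma measurable_history_snd:
  assumes "\<pi> \<in> policies k N"
  shows "(\<lambda>u. history k \<pi> z u N) \<in> lborel_pow k \<rightarrow>\<^sub>M count_space (answers k N)"
  using measurable_compose[OF measurable_Pair1' measurable_history[OF assms order_refl], of z] by simp

text \<open>The constraints use the questions asked along \<open>u\<close>. As long as the earlier
  answers agree, \<open>v\<close> would be asked the same next question, so meeting the constraints
  amounts to producing the same history.\<close>

lemma consistent_eq_history:
  "consistent k \<pi> z u n = {v \<in> space (lborel_pow k). history k \<pi> z v n = history k \<pi> z u n}"
proof -
  have "(\<forall>m\<in>{1..n}. answer k \<pi> z u m = (\<Sum>i=1..k. indicator (question k \<pi> z u m) (v i))) \<longleftrightarrow>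
      history k \<pi> z v n = history k \<pi> z u n" for v
  proof (induction n)
    case (Suc n)
    have upd: "history k \<pi> z w (Suc n) = (history k \<pi> z w n)(Suc n := answer k \<pi> z w (Suc n))" for w
      by (simp add: answer_def question_def)
    have und: "history k \<pi> z w n (Suc n) = undefined" for w
      by (simp add: history_eq_restrict_answer)
    have "(\<forall>m\<in>{1..Suc n}. answer k \<pi> z u m = (\<Sum>i=1..k. indicator (question k \<pi> z u m) (v i))) \<longleftrightarrow>
        history k \<pi> z v n = history k \<pi> z u n \<and>
        answer k \<pi> z u (Suc n) = (\<Sum>i=1..k. indicator (question k \<pi> z u (Suc n)) (v i))"
      unfolding Suc.IH[symmetric] by (auto simp: le_Suc_eq)
    also have "\<dots> \<longleftrightarrow> history k \<pi> z v n = history k \<pi> z u n \<and> answer k \<pi> z u (Suc n) = answer k \<pi> z v (Suc n)"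
      by (auto simp: answer_def question_def)
    also have "\<dots> \<longleftrightarrow> history k \<pi> z v (Suc n) = history k \<pi> z u (Suc n)"
      unfolding upd using und by (metis fun_upd_idem_iff fun_upd_same fun_upd_upd)
    finally show ?case .
  qed simp
  then show ?thesis by (simp add: consistent_def)
qed

section \<open>The prior as a product law with a density\<close>

locale iid_prior =
  fixes f0 :: "real \<Rightarrow> real" and k :: nat
  assumes f0_measurable [measurable]: "f0 \<in> borel_measurable borel"
    and f0_nonneg: "\<And>x. 0 \<le> f0 x"
    and prob_f0: "prob_space (density lborel (\<lambda>x. ennreal (f0 x)))"
    and finite_entropy_prior: "integrable (lborel_pow k) (\<lambda>u. prior f0 k u * log 2 (prior f0 k u))"
begin

abbreviation "\<mu> \<equiv> density lborel (\<lambda>x. ennreal (f0 x))"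
abbreviation "P \<equiv> Pi\<^sub>M {1..k} (\<lambda>_. \<mu>)"

lemma prior_nonneg: "0 \<le> prior f0 k u"
  by (simp add: prior_def f0_nonneg prod_nonneg)

lemma prior_measurable [measurable]: "prior f0 k \<in> borel_measurable (lborel_pow k)"
  unfolding prior_def by measurable

lemma sets_P: "sets P = sets (lborel_pow k)"
  by (intro sets_PiM_cong) auto

lemma space_P: "space P = space (lborel_pow k)"
  by (rule sets_eq_imp_space_eq[OF sets_P])

text \<open>Connects the law of the vector with the density that enters the posterior. On boxes the
  integral of the product density factorises.\<close>

lemma P_eq_density: "P = density (lborel_pow k) (\<lambda>u. ennreal (prior f0 k u))"
proof -
  interpret \<mu>: prob_space \<mu> by (rule prob_f0)
  interpret \<mu>s: product_sigma_finite "\<lambda>_. \<mu>" ..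
  interpret L: product_sigma_finite "\<lambda>_. lborel :: real measure" ..
  show ?thesis
  proof (rule \<mu>s.PiM_eqI[symmetric])
    fix A :: "nat \<Rightarrow> real set" assume "\<And>i. i \<in> {1..k} \<Longrightarrow> A i \<in> sets \<mu>"
    then have A: "A i \<in> sets lborel" if "i \<in> {1..k}" for i using that by simp
    have "emeasure (density (lborel_pow k) (\<lambda>u. ennreal (prior f0 k u))) (Pi\<^sub>E {1..k} A) =
        (\<integral>\<^sup>+u. ennreal (prior f0 k u) * indicator (Pi\<^sub>E {1..k} A) u \<partial>lborel_pow k)"
      using A by (intro emeasure_density sets_PiM_I_finite) auto
    also have "\<dots> = (\<integral>\<^sup>+u. (\<Prod>i=1..k. ennreal (f0 (u i)) * indicator (A i) (u i)) \<partial>lborel_pow k)"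
    proof (intro nn_integral_cong)
      fix u assume u: "u \<in> space (lborel_pow k)"
      have "(\<Prod>i=1..k. indicator (A i) (u i)) = (indicator (Pi\<^sub>E {1..k} A) u :: ennreal)"
        using u by (auto simp: indicator_def space_PiM PiE_iff prod_zero_iff)
      then show "ennreal (prior f0 k u) * indicator (Pi\<^sub>E {1..k} A) u =
          (\<Prod>i=1..k. ennreal (f0 (u i)) * indicator (A i) (u i))"
        by (simp add: prior_def prod.distrib prod_ennreal f0_nonneg)
    qed
    also have "\<dots> = (\<Prod>i=1..k. \<integral>\<^sup>+t. ennreal (f0 t) * indicator (A i) t \<partial>lborel)"
      using A by (intro L.product_nn_integral_prod) auto
    also have "\<dots> = (\<Prod>i=1..k. emeasure \<mu> (A i))"
      using A by (intro prod.cong refl emeasure_density[symmetric]) auto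
    finally show "emeasure (density (lborel_pow k) (\<lambda>u. ennreal (prior f0 k u))) (Pi\<^sub>E {1..k} A) = \<dots>" .
  qed (auto simp: sets_P)
qed

lemma prob_space_P: "prob_space P"
  by (intro prob_space_PiM prob_f0)

lemma integrable_prior: "integrable (lborel_pow k) (prior f0 k)"
proof -
  interpret P: prob_space P by (rule prob_space_P)
  have "integrable P (\<lambda>_. 1 :: real)" by simp
  then show ?thesis
    unfolding P_eq_density by (subst (asm) integrable_real_density) (auto simp: prior_nonneg)
qed

lemma measure_P:
  assumes [measurable]: "B \<in> sets (lborel_pow k)"
  shows "measure P B = (\<integral>w. indicator B w * prior f0 k w \<partial>lborel_pow k)"
proof -
  have "measure P B = (\<integral>w. indicator B w \<partial>P)"
    using sets.sets_into_space[OF assms] by (simp add: space_P Int_absorb2)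
  also have "\<dots> = (\<integral>w. prior f0 k w * indicator B w \<partial>lborel_pow k)"
    unfolding P_eq_density by (intro integral_real_density) (auto simp: prior_nonneg)
  finally show ?thesis by (simp add: mult.commute)
qed

text \<open>The share of \<open>B\<close> in the prior entropy. It is additive over a partition,
  unlike the entropy of a conditioned density.\<close>

definition partial_entropy :: "(nat \<Rightarrow> real) set \<Rightarrow> real" where
  "partial_entropy B = - (\<integral>w. indicator B w * (prior f0 k w * log 2 (prior f0 k w)) \<partial>lborel_pow k)"

text \<open>If \<open>measure P B = 0\<close>, then both sides vanish because \<open>x / 0 = 0\<close> and \<open>log 2 0 = 0\<close>.\<close>

lemma diff_entropy_conditioned:
  assumes [measurable]: "B \<in> sets (lborel_pow k)"
  shows "diff_entropy k (\<lambda>v. indicator B v * prior f0 k v / (\<integral>w. indicator B w * prior f0 k w \<partial>lborel_pow k)) =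
    partial_entropy B / measure P B + log 2 (measure P B)"
proof (cases "measure P B = 0")
  case True
  then show ?thesis by (simp add: diff_entropy_def measure_P[symmetric] log_def)
next
  case False
  define c where "c = measure P B"
  have c: "0 < c" using False by (simp add: c_def less_le)
  have int1: "integrable (lborel_pow k) (\<lambda>w. indicator B w * (prior f0 k w * log 2 (prior f0 k w)))"
    using integrable_real_mult_indicator[OF assms finite_entropy_prior] by (simp add: mult.commute)
  have int2: "integrable (lborel_pow k) (\<lambda>w. indicator B w * prior f0 k w)"
    using integrable_real_mult_indicator[OF assms integrable_prior] by (simp add: mult.commute)
  have "(\<integral>v. indicator B v * prior f0 k v / c * log 2 (indicator B v * prior f0 k v / c) \<partial>lborel_pow k) =
      (\<integral>v. (1 / c) * (indicator B v * (prior f0 k v * log 2 (prior f0 k v)))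
        - (log 2 c / c) * (indicator B v * prior f0 k v) \<partial>lborel_pow k)"
  proof (intro Bochner_Integration.integral_cong refl)
    fix v
    \<comment> \<open>The logarithm splits only where the prior is nonzero; elsewhere both
      integrands vanish through their factors.\<close>
    have *: "log 2 (prior f0 k v / c) = log 2 (prior f0 k v) - log 2 c" if "prior f0 k v \<noteq> 0"
      using that c prior_nonneg[of v] by (simp add: log_def ln_div less_le diff_divide_distrib)
    then show "indicator B v * prior f0 k v / c * log 2 (indicator B v * prior f0 k v / c) =
        (1 / c) * (indicator B v * (prior f0 k v * log 2 (prior f0 k v)))
        - (log 2 c / c) * (indicator B v * prior f0 k v)"
      by (cases "prior f0 k v = 0") (simp_all add: * indicator_def right_diff_distrib diff_divide_distrib)
  qed
  also have "\<dots> = (1 / c) * (- partial_entropy B) - (log 2 c / c) * c"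
    using int1 int2 by (simp add: partial_entropy_def c_def measure_P[symmetric])
  finally show ?thesis
    using c by (simp add: diff_entropy_def measure_P[OF assms, symmetric] c_def[symmetric])
qed

text \<open>Needed for histories of probability 0: their posterior entropy is a default value of
  weight 0, and their share of the prior entropy must be 0 too. Indeed the prior vanishes almost
  everywhere on \<open>B\<close>.\<close>

lemma partial_entropy_null:
  assumes [measurable]: "B \<in> sets (lborel_pow k)" and "measure P B = 0"
  shows "partial_entropy B = 0"
proof -
  have int: "integrable (lborel_pow k) (\<lambda>w. indicator B w * prior f0 k w)"
    using integrable_real_mult_indicator[OF assms(1) integrable_prior] by (simp add: mult.commute)
  have "AE w in lborel_pow k. indicator B w * prior f0 k w = 0"
    using assms(2) unfolding measure_P[OF assms(1)]
    by (subst (asm) integral_nonneg_eq_0_iff_AE[OF int]) (auto simp: prior_nonneg)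
  then have "AE w in lborel_pow k. indicator B w * (prior f0 k w * log 2 (prior f0 k w)) = 0"
    by eventually_elim auto
  then show ?thesis
    by (simp add: partial_entropy_def integral_eq_zero_AE)
qed

lemma abs_partial_entropy_le:
  assumes [measurable]: "B \<in> sets (lborel_pow k)"
  shows "\<bar>partial_entropy B\<bar> \<le> (\<integral>w. \<bar>prior f0 k w * log 2 (prior f0 k w)\<bar> \<partial>lborel_pow k)"
proof -
  have int1: "integrable (lborel_pow k) (\<lambda>w. indicator B w * (prior f0 k w * log 2 (prior f0 k w)))"
    using integrable_real_mult_indicator[OF assms finite_entropy_prior] by (simp add: mult.commute)
  have "\<bar>partial_entropy B\<bar> \<le> (\<integral>w. \<bar>indicator B w * (prior f0 k w * log 2 (prior f0 k w))\<bar> \<partial>lborel_pow k)"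
    unfolding partial_entropy_def abs_minus by (rule integral_abs_bound)
  also have "\<dots> \<le> (\<integral>w. \<bar>prior f0 k w * log 2 (prior f0 k w)\<bar> \<partial>lborel_pow k)"
    using int1 finite_entropy_prior by (intro integral_mono integrable_abs) (auto simp: indicator_def)
  finally show ?thesis .
qed


section \<open>Posterior entropy as a function of the history\<close>

definition history_event :: "policy \<Rightarrow> nat \<Rightarrow> real \<Rightarrow> (nat \<Rightarrow> nat) \<Rightarrow> (nat \<Rightarrow> real) set" where
  "history_event \<pi> N z x = {w \<in> space (lborel_pow k). history k \<pi> z w N = x}"

text \<open>For fixed \<open>z\<close> the entropy of the posterior depends on the history alone, so
  expectations under \<open>P\<close> become finite sums.\<close>

definition posterior_entropy :: "policy \<Rightarrow> nat \<Rightarrow> real \<Rightarrow> (nat \<Rightarrow> nat) \<Rightarrow> real" where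
  "posterior_entropy \<pi> N z x = partial_entropy (history_event \<pi> N z x) / measure P (history_event \<pi> N z x)
     + log 2 (measure P (history_event \<pi> N z x))"

lemma history_in_answers: "history k \<pi> z u n \<in> answers k n"
  by (simp add: history_eq_restrict_answer answer_le)

context
  fixes \<pi> :: policy and N :: nat
  assumes \<pi>: "\<pi> \<in> policies k N"
begin

lemma history_event_sets: "x \<in> answers k N \<Longrightarrow> history_event \<pi> N z x \<in> sets (lborel_pow k)"
  using measurable_sets[OF measurable_history_snd[OF \<pi>, of z], of "{x}"]
  by (simp add: history_event_def vimage_def Int_def conj_commute)

lemma diff_entropy_posterior:
  "diff_entropy k (posterior f0 k \<pi> z u N) = posterior_entropy \<pi> N z (history k \<pi> z u N)"
  unfolding posterior_entropy_def
  using diff_entropy_conditioned[OF history_event_sets[where z = z, OF history_in_answers[of \<pi> z u N]]]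
  by (simp add: posterior_def[abs_def] consistent_eq_history history_event_def)

lemma measurable_history_snd_P:
  "(\<lambda>u. history k \<pi> z u N) \<in> P \<rightarrow>\<^sub>M count_space (answers k N)"
  using measurable_history_snd[OF \<pi>] by (simp add: measurable_cong_sets[OF sets_P refl])

lemma integral_posterior_function:
  fixes f :: "(nat \<Rightarrow> nat) \<Rightarrow> real"
  shows "(\<integral>u. f (history k \<pi> z u N) \<partial>P) = (\<Sum>x\<in>answers k N. measure P (history_event \<pi> N z x) * f x)"
    and "integrable P (\<lambda>u. f (history k \<pi> z u N))"
proof -
  interpret P: prob_space P by (rule prob_space_P)
  show "(\<integral>u. f (history k \<pi> z u N) \<partial>P) = (\<Sum>x\<in>answers k N. measure P (history_event \<pi> N z x) * f x)"
    using P.integral_finite_valued(1)[OF measurable_history_snd_P finite_answers, of f z]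
    by (simp add: history_event_def space_P)
  show "integrable P (\<lambda>u. f (history k \<pi> z u N))"
    by (rule P.integral_finite_valued(2)[OF measurable_history_snd_P finite_answers])
qed

text \<open>For fixed \<open>z\<close> the history events partition the space, so their indicators
  sum to 1.\<close>

lemma sum_partial_entropy:
  "(\<Sum>x\<in>answers k N. partial_entropy (history_event \<pi> N z x)) = diff_entropy k (prior f0 k)"
proof -
  let ?g = "\<lambda>w. prior f0 k w * log 2 (prior f0 k w)"
  have "(\<Sum>x\<in>answers k N. partial_entropy (history_event \<pi> N z x)) =
      - (\<integral>w. (\<Sum>x\<in>answers k N. indicator (history_event \<pi> N z x) w * ?g w) \<partial>lborel_pow k)"
    unfolding partial_entropy_def sum_negf
    using integrable_real_mult_indicator[OF history_event_sets finite_entropy_prior]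
    by (subst Bochner_Integration.integral_sum) (auto simp: mult.commute)
  also have "(\<integral>w. (\<Sum>x\<in>answers k N. indicator (history_event \<pi> N z x) w * ?g w) \<partial>lborel_pow k) =
      (\<integral>w. ?g w \<partial>lborel_pow k)"
  proof (intro Bochner_Integration.integral_cong refl)
    fix w assume "w \<in> space (lborel_pow k)"
    then have "(\<Sum>x\<in>answers k N. indicator (history_event \<pi> N z x) w * ?g w) =
        (\<Sum>x\<in>answers k N. if x = history k \<pi> z w N then ?g w else 0)"
      by (intro sum.cong) (auto simp: history_event_def indicator_def)
    also have "\<dots> = ?g w"
      using history_in_answers by (simp only: sum.delta finite_answers if_True)
    finally show "(\<Sum>x\<in>answers k N. indicator (history_event \<pi> N z x) w * ?g w) = ?g w" .
  qed
  finally show ?thesis by (simp add: diff_entropy_def)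
qed

text \<open>Weighting by the probability p of a history cancels the normalisation: each history
  contributes its partial entropy plus p log p. The identity holds for adaptive policies as
  well.\<close>

lemma integral_posterior_entropy:
  "(\<integral>u. diff_entropy k (posterior f0 k \<pi> z u N) \<partial>P) =
     diff_entropy k (prior f0 k) - finite_entropy P (answers k N) (\<lambda>u. history k \<pi> z u N)"
proof -
  let ?p = "\<lambda>x. measure P (history_event \<pi> N z x)"
  have "(\<integral>u. diff_entropy k (posterior f0 k \<pi> z u N) \<partial>P) =
      (\<Sum>x\<in>answers k N. ?p x * posterior_entropy \<pi> N z x)"
    unfolding diff_entropy_posterior by (rule integral_posterior_function)
  also have "\<dots> = (\<Sum>x\<in>answers k N. partial_entropy (history_event \<pi> N z x) + ?p x * log 2 (?p x))"
    using partial_entropy_null[OF history_event_sets]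
    by (intro sum.cong refl) (simp add: posterior_entropy_def distrib_left)
  also have "\<dots> = diff_entropy k (prior f0 k) - finite_entropy P (answers k N) (\<lambda>u. history k \<pi> z u N)"
  proof -
    have "finite_entropy P (answers k N) (\<lambda>u. history k \<pi> z u N) =
        - (\<Sum>x\<in>answers k N. ?p x * log 2 (?p x))"
      by (simp add: finite_entropy_def history_event_def space_P)
    then show ?thesis by (simp add: sum.distrib sum_partial_entropy)
  qed
  finally show ?thesis .
qed

text \<open>A bound uniform in \<open>z\<close>, for Fubini. The normalisation divides by the
  probability of the history, but the weight in the expectation restores that factor.\<close>

lemma abs_posterior_entropy_bounded:
  "\<exists>C. \<forall>z. (\<integral>u. \<bar>diff_entropy k (posterior f0 k \<pi> z u N)\<bar> \<partial>P) \<le> C"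
proof -
  interpret P: prob_space P by (rule prob_space_P)
  define c where "c = (\<integral>w. \<bar>prior f0 k w * log 2 (prior f0 k w)\<bar> \<partial>lborel_pow k)"
  have "(\<integral>u. \<bar>diff_entropy k (posterior f0 k \<pi> z u N)\<bar> \<partial>P) \<le> (\<Sum>x\<in>answers k N. c + 1 / ln 2)" for z
  proof -
    let ?B = "history_event \<pi> N z"
    have "(\<integral>u. \<bar>diff_entropy k (posterior f0 k \<pi> z u N)\<bar> \<partial>P) =
        (\<Sum>x\<in>answers k N. measure P (?B x) * \<bar>posterior_entropy \<pi> N z x\<bar>)"
      unfolding diff_entropy_posterior by (rule integral_posterior_function)
    also have "\<dots> \<le> (\<Sum>x\<in>answers k N. c + 1 / ln 2)"
    proof (intro sum_mono)
      fix x assume x: "x \<in> answers k N"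
      define p where "p = measure P (?B x)"
      have S: "\<bar>partial_entropy (?B x)\<bar> \<le> c"
        unfolding c_def by (intro abs_partial_entropy_le history_event_sets x)
      show "measure P (?B x) * \<bar>posterior_entropy \<pi> N z x\<bar> \<le> c + 1 / ln 2"
      proof (cases "p = 0")
        case False
        then have p: "0 < p" "p \<le> 1" by (auto simp: p_def less_le)
        \<comment> \<open>The constant \<open>1 / ln 2\<close> comes from ln (1/p) <= 1/p - 1, which
          gives -p ln p <= 1 - p <= 1.\<close>
        have "p * (- ln p) \<le> p * (1 / p - 1)"
          using p ln_le_minus_one[of "1 / p"] by (intro mult_left_mono) (auto simp: ln_div)
        also have "\<dots> \<le> 1" using p by (simp add: right_diff_distrib)
        finally have "p * (- ln p) / ln 2 \<le> 1 / ln 2"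
          by (intro divide_right_mono) auto
        moreover have "\<bar>p * log 2 p\<bar> = p * (- ln p) / ln 2"
          using p by (simp add: log_def abs_mult abs_of_nonpos)
        ultimately have "\<bar>p * log 2 p\<bar> \<le> 1 / ln 2" by (simp only:)
        then have "\<bar>partial_entropy (?B x) + p * log 2 p\<bar> \<le> c + 1 / ln 2"
          using S by linarith
        moreover have "p * \<bar>posterior_entropy \<pi> N z x\<bar> = \<bar>p * posterior_entropy \<pi> N z x\<bar>"
          using p by (simp add: abs_mult)
        moreover have "p * posterior_entropy \<pi> N z x = partial_entropy (?B x) + p * log 2 p"
          using p by (simp add: posterior_entropy_def p_def[symmetric] distrib_left)
        ultimately show ?thesis unfolding p_def[symmetric] by (simp only:)
      next
        case True
        have "0 \<le> c" using S by linarith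
        then show ?thesis using True by (simp add: p_def)
      qed
    qed
    finally show ?thesis .
  qed
  then show ?thesis by (intro exI allI)
qed

text \<open>For each of the finitely many histories the value is measurable in \<open>z\<close>,
  being built from integrals of jointly measurable indicators; the measurable history then selects
  which value applies.\<close>

lemma measurable_posterior_entropy:
  "(\<lambda>x. diff_entropy k (posterior f0 k \<pi> (fst x) (snd x) N)) \<in> borel_measurable (borel \<Otimes>\<^sub>M lborel_pow k)"
proof -
  interpret L: product_sigma_finite "\<lambda>_. lborel :: real measure" ..
  interpret L: sigma_finite_measure "lborel_pow k" by (rule L.sigma_finite) simp
  have ind: "(\<lambda>x. indicator (history_event \<pi> N (fst x) y) (snd x) :: real)
      \<in> borel_measurable (borel \<Otimes>\<^sub>M lborel_pow k)" if "y \<in> answers k N" for y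
  proof -
    have "{x \<in> space (borel \<Otimes>\<^sub>M lborel_pow k). history k \<pi> (fst x) (snd x) N = y} \<in> sets (borel \<Otimes>\<^sub>M lborel_pow k)"
      using measurable_sets[OF measurable_history[OF \<pi> order_refl], of "{y}"] that
      by (simp add: vimage_def Int_def conj_commute)
    then have "(indicator {x \<in> space (borel \<Otimes>\<^sub>M lborel_pow k). history k \<pi> (fst x) (snd x) N = y} :: _ \<Rightarrow> real)
        \<in> borel_measurable (borel \<Otimes>\<^sub>M lborel_pow k)"
      by (rule borel_measurable_indicator)
    then show ?thesis
      by (rule measurable_cong[THEN iffD1, rotated])
         (auto simp: indicator_def history_event_def space_pair_measure)
  qed
  have m1: "(\<lambda>z. measure P (history_event \<pi> N z y)) \<in> borel_measurable borel" if y: "y \<in> answers k N" for y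
    unfolding measure_P[OF history_event_sets[OF y]]
    by (rule L.borel_measurable_lebesgue_integral) (use ind[OF y] in \<open>simp add: case_prod_beta'\<close>)
  have m2: "(\<lambda>z. partial_entropy (history_event \<pi> N z y)) \<in> borel_measurable borel" if y: "y \<in> answers k N" for y
    unfolding partial_entropy_def
    by (intro borel_measurable_uminus L.borel_measurable_lebesgue_integral)
       (use ind[OF y] in \<open>simp add: case_prod_beta'\<close>)
  have "(\<lambda>z. posterior_entropy \<pi> N z y) \<in> borel_measurable borel" if y: "y \<in> answers k N" for y
    unfolding posterior_entropy_def using m1[OF y] m2[OF y] by measurable
  then show ?thesis
    unfolding diff_entropy_posterior
    by (intro measurable_compose_countable'[where f = "\<lambda>y x. posterior_entropy \<pi> N (fst x) y",
          OF measurable_compose[OF measurable_fst] measurable_history[OF \<pi> order_refl]]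
        countable_finite finite_answers)
qed

text \<open>Fubini applied to the identity for fixed \<open>z\<close>. The integrability claim later
  permits comparing policies almost everywhere in \<open>z\<close>.\<close>

lemma expected_posterior_entropy:
  assumes "prob_space U" and U: "sets U = sets borel"
  shows "(\<integral>x. diff_entropy k (posterior f0 k \<pi> (fst x) (snd x) N) \<partial>(U \<Otimes>\<^sub>M P)) =
      (\<integral>z. diff_entropy k (prior f0 k) - finite_entropy P (answers k N) (\<lambda>u. history k \<pi> z u N) \<partial>U)"
    and "integrable U (\<lambda>z. diff_entropy k (prior f0 k) - finite_entropy P (answers k N) (\<lambda>u. history k \<pi> z u N))"
proof -
  interpret U: prob_space U by fact
  interpret P: prob_space P by (rule prob_space_P)
  interpret UP: pair_sigma_finite U P ..
  let ?E = "\<lambda>x. diff_entropy k (posterior f0 k \<pi> (fst x) (snd x) N)"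
  have m: "?E \<in> borel_measurable (U \<Otimes>\<^sub>M P)"
    using measurable_posterior_entropy
    by (simp add: measurable_cong_sets[OF sets_pair_measure_cong[OF U sets_P] refl])
  obtain C where C: "\<forall>z. (\<integral>u. \<bar>diff_entropy k (posterior f0 k \<pi> z u N)\<bar> \<partial>P) \<le> C"
    by (rule exE[OF abs_posterior_entropy_bounded])
  have int: "integrable (U \<Otimes>\<^sub>M P) ?E"
  proof (rule UP.Fubini_integrable[OF m])
    show "integrable U (\<lambda>z. \<integral>u. norm (?E (z, u)) \<partial>P)"
    proof (rule U.integrable_const_bound[where B = C])
      show "(\<lambda>z. \<integral>u. norm (?E (z, u)) \<partial>P) \<in> borel_measurable U"
        by (rule P.borel_measurable_lebesgue_integral) (use m in \<open>simp add: case_prod_beta'\<close>)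
    qed (use C in simp)
    show "AE z in U. integrable P (\<lambda>u. ?E (z, u))"
      by (simp add: diff_entropy_posterior integral_posterior_function(2))
  qed
  show "(\<integral>x. ?E x \<partial>(U \<Otimes>\<^sub>M P)) =
      (\<integral>z. diff_entropy k (prior f0 k) - finite_entropy P (answers k N) (\<lambda>u. history k \<pi> z u N) \<partial>U)"
    using UP.integral_fst'[OF int] by (simp add: integral_posterior_entropy)
  show "integrable U (\<lambda>z. diff_entropy k (prior f0 k) - finite_entropy P (answers k N) (\<lambda>u. history k \<pi> z u N))"
    using UP.integrable_fst'[OF int] by (simp add: integral_posterior_entropy)
qed

end

end

section \<open>Entropy of non-adaptive histories\<close>

text \<open>The counterpart of \<open>answer\<close> for a question set fixed in advance.\<close>

definition answer_count :: "nat \<Rightarrow> real set \<Rightarrow> (nat \<Rightarrow> real) \<Rightarrow> nat" where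
  "answer_count k A u = (\<Sum>i=1..k. indicator A (u i))"

lemma binom_mean_indicator:
  "j \<le> k \<Longrightarrow> binom_mean k q (indicator {j}) = real (k choose j) * q ^ j * (1 - q) ^ (k - j)"
  by (simp add: binom_mean_def indicator_def sum.delta if_distrib[of "\<lambda>b. _ * b"] cong: if_cong)

context iid_prior
begin

lemma measurable_count: "A \<in> sets borel \<Longrightarrow> answer_count k A \<in> P \<rightarrow>\<^sub>M count_space {0..k}"
proof (rule measurable_count_space_bounded)
  assume [measurable]: "A \<in> sets borel"
  show "answer_count k A \<in> P \<rightarrow>\<^sub>M count_space UNIV"
    unfolding answer_count_def indicator_def by (intro measurable_count_space_sum_nat) measurable
next
  fix u
  show "answer_count k A u \<in> {0..k}"
    using sum_mono[of "{1..k}" "\<lambda>i. indicator A (u i)" "\<lambda>_. 1 :: nat"]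
    by (simp add: answer_count_def indicator_def)
qed

text \<open>The case of \<open>expectation_prod_counts\<close> in which \<open>g n\<close> is the
  indicator of the prescribed count. The index type is arbitrary, so that a single question is also
  covered.\<close>

lemma prob_counts:
  fixes A :: "'n \<Rightarrow> real set"
  assumes "finite J" and A: "\<And>n. n \<in> J \<Longrightarrow> A n \<in> sets borel"
    and indep: "\<And>S. S \<subseteq> J \<Longrightarrow> measure \<mu> (space \<mu> \<inter> (\<Inter>n\<in>S. A n)) = (\<Prod>n\<in>S. q n)"
    and x: "\<And>n. n \<in> J \<Longrightarrow> x n \<in> {0..k}"
  shows "measure P {u \<in> space P. \<forall>n\<in>J. answer_count k (A n) u = x n} = (\<Prod>n\<in>J. binom_mean k (q n) (indicator {x n}))"
proof -
  have "measure P {u \<in> space P. \<forall>n\<in>J. answer_count k (A n) u = x n} =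
      (\<integral>u. indicator {u \<in> space P. \<forall>n\<in>J. answer_count k (A n) u = x n} u \<partial>P)"
    by (simp, intro arg_cong[where f = "measure P"]) auto
  also have "\<dots> = (\<integral>u. (\<Prod>n\<in>J. indicator {x n} (\<Sum>i=1..k. indicator (A n) (u i))) \<partial>P)"
  proof (intro Bochner_Integration.integral_cong refl)
    fix u assume "u \<in> space P"
    have "(\<Prod>n\<in>J. indicator {x n} (answer_count k (A n) u)) =
        (if \<forall>n\<in>J. answer_count k (A n) u = x n then 1 else 0 :: real)"
      using \<open>finite J\<close> by (auto simp: indicator_def)
    then show "indicator {u \<in> space P. \<forall>n\<in>J. answer_count k (A n) u = x n} u =
        (\<Prod>n\<in>J. indicator {x n} (\<Sum>i=1..k. indicator (A n) (u i)) :: real)"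
      using \<open>u \<in> space P\<close> by (simp add: answer_count_def indicator_def)
  qed
  also have "\<dots> = (\<Prod>n\<in>J. binom_mean (card {1..k}) (q n) (indicator {x n}))"
    using A indep by (intro expectation_prod_counts prob_f0 \<open>finite J\<close>) auto
  finally show ?thesis by simp
qed

lemma prob_count:
  assumes A: "A \<in> sets borel" and "j \<le> k"
  shows "measure P {u \<in> space P. answer_count k A u = j} = binom_mean k (measure \<mu> A) (indicator {j})"
proof -
  interpret \<mu>: prob_space \<mu> by (rule prob_f0)
  \<comment> \<open>With the one-element index type the product formula is trivial for both possible
    \<open>S\<close>.\<close>
  have "measure \<mu> (space \<mu> \<inter> (\<Inter>n\<in>S. A)) = (\<Prod>n\<in>S. measure \<mu> A)" if "S \<subseteq> {()}" for S
    using that \<mu>.prob_space by (cases "S = {}") (auto simp: subset_singleton_iff)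
  from prob_counts[of "{()}" "\<lambda>_. A" "\<lambda>_. measure \<mu> A" "\<lambda>_. j", OF _ _ this]
  show ?thesis using assms by simp
qed

lemma finite_entropy_count:
  assumes A: "A \<in> sets borel"
  shows "finite_entropy P {0..k} (answer_count k A) = binom_entropy k (measure \<mu> A)"
proof -
  let ?w = "\<lambda>j. real (k choose j) * measure \<mu> A ^ j * (1 - measure \<mu> A) ^ (k - j)"
  have "finite_entropy P {0..k} (answer_count k A) = - (\<Sum>j\<le>k. ?w j * log 2 (?w j))"
    unfolding finite_entropy_def atLeast0AtMost
    by (intro arg_cong[where f = uminus] sum.cong) (simp_all add: prob_count[OF A] binom_mean_indicator)
  then show ?thesis by (simp add: binom_entropy_def binom_mean_def)
qed

text \<open>Once \<open>z\<close> is fixed the questions are fixed sets, so the history consists of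
  binomial counts. The bound can lose in two places, subadditivity and the comparison with q = 1/2.
  The product formula closes both gaps, its singleton cases giving probability 1/2.\<close>

lemma nonadaptive_history_entropy:
  assumes \<pi>: "\<pi> \<in> policies k N"
    and A: "\<And>u n. u \<in> space P \<Longrightarrow> n \<in> {1..N} \<Longrightarrow> question k \<pi> z u n = A n"
  shows "finite_entropy P (answers k N) (\<lambda>u. history k \<pi> z u N) \<le> real N * binom_entropy k (1 / 2)"
    and "(\<And>S. S \<subseteq> {1..N} \<Longrightarrow> measure \<mu> (space \<mu> \<inter> (\<Inter>n\<in>S. A n)) = (\<Prod>n\<in>S. 1 / 2)) \<Longrightarrow>
       finite_entropy P (answers k N) (\<lambda>u. history k \<pi> z u N) = real N * binom_entropy k (1 / 2)"
proof -
  interpret \<mu>: prob_space \<mu> by (rule prob_f0)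
  interpret P: prob_space P by (rule prob_space_P)
  \<comment> \<open>The space is nonempty, so \<open>A n\<close> is the question asked at some point
    and is Borel by \<open>question_sets\<close>.\<close>
  have A_sets: "A n \<in> sets borel" if "n \<in> {1..N}" for n
    using question_sets[OF \<pi> that] A[OF _ that] P.not_empty by (metis ex_in_conv)
  have hist: "history k \<pi> z u N n = answer_count k (A n) u" if "u \<in> space P" "n \<in> {1..N}" for u n
    using that A by (simp add: history_eq_restrict_answer answer_def answer_count_def)
  note X = measurable_count[OF A_sets] and T = measurable_history_snd_P[OF \<pi>, of z]
  have "finite_entropy P (answers k N) (\<lambda>u. history k \<pi> z u N) \<le>
      (\<Sum>n\<in>{1..N}. finite_entropy P {0..k} (answer_count k (A n)))"
    by (rule P.finite_entropy_subadditive[OF _ _ X T hist]) auto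
  also have "\<dots> \<le> (\<Sum>n\<in>{1..N}. binom_entropy k (1 / 2))"
    by (intro sum_mono) (simp only: finite_entropy_count A_sets binom_entropy_le_half measure_nonneg \<mu>.prob_le_1)
  finally show "finite_entropy P (answers k N) (\<lambda>u. history k \<pi> z u N) \<le> real N * binom_entropy k (1 / 2)"
    by simp
  assume indep: "\<And>S. S \<subseteq> {1..N} \<Longrightarrow> measure \<mu> (space \<mu> \<inter> (\<Inter>n\<in>S. A n)) = (\<Prod>n\<in>S. 1 / 2)"
  have half: "measure \<mu> (A n) = 1 / 2" if "n \<in> {1..N}" for n
    using indep[of "{n}"] that by simp
  have "finite_entropy P (answers k N) (\<lambda>u. history k \<pi> z u N) =
      (\<Sum>n\<in>{1..N}. finite_entropy P {0..k} (answer_count k (A n)))"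
  proof (rule P.finite_entropy_additive[OF _ _ X T hist])
    fix x assume x: "x \<in> answers k N"
    \<comment> \<open>Both tuples are extensional, so agreement on the coordinates 1 to
      \<open>N\<close> is equality.\<close>
    have "history k \<pi> z u N = x \<longleftrightarrow> (\<forall>n\<in>{1..N}. answer_count k (A n) u = x n)" if "u \<in> space P" for u
      using PiE_ext[OF history_in_answers x] hist[OF that] by metis
    then have "measure P {u \<in> space P. history k \<pi> z u N = x} =
        measure P {u \<in> space P. \<forall>n\<in>{1..N}. answer_count k (A n) u = x n}"
      by (intro arg_cong[where f = "measure P"]) auto
    also have "\<dots> = (\<Prod>n\<in>{1..N}. binom_mean k (1 / 2) (indicator {x n}))"
      using x by (intro prob_counts A_sets indep) auto
    also have "\<dots> = (\<Prod>n\<in>{1..N}. measure P {u \<in> space P. answer_count k (A n) u = x n})"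
    proof (intro prod.cong refl)
      fix n assume n: "n \<in> {1..N}"
      then have "x n \<le> k" using x by (auto simp: PiE_iff)
      then show "binom_mean k (1 / 2) (indicator {x n}) = measure P {u \<in> space P. answer_count k (A n) u = x n}"
        unfolding prob_count[OF A_sets[OF n] \<open>x n \<le> k\<close>] half[OF n] by simp
    qed
    finally show "measure P {u \<in> space P. history k \<pi> z u N = x} = \<dots>" .
  qed auto
  then show "finite_entropy P (answers k N) (\<lambda>u. history k \<pi> z u N) = real N * binom_entropy k (1 / 2)"
    by (simp add: finite_entropy_count A_sets half)
qed

text \<open>Every history lies in the space of answer tuples, so for \<open>z\<close> in [0, 1] only
  the last component of the policy is a real condition.\<close>

lemma question_dyadic:
  "n \<ge> 1 \<Longrightarrow> z \<in> {0..1} \<Longrightarrow> question k (dyadic_policy f0 k) z u n = dyadic_question f0 n"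
  using history_in_answers[of "dyadic_policy f0 k" z u "n - 1"]
  by (cases n) (auto simp: question_def dyadic_policy_def atLeastLessThanSuc_atLeastAtMost)

lemma dyadic_policy_nonadaptive: "dyadic_policy f0 k \<in> nonadaptive_policies k N"
proof -
  have "dyadic_policy f0 k n \<in> sets (restrict_space borel {0..1} \<Otimes>\<^sub>M
      (Pi\<^sub>M {1..<n} (\<lambda>_. count_space {0..k}) \<Otimes>\<^sub>M borel))" for n
    unfolding dyadic_policy_def
    using dyadic_question_measurable[OF f0_measurable f0_nonneg prob_f0]
    by (intro pair_measureI sets_PiM_I_finite) (auto simp: sets_restrict_space_iff)
  then show ?thesis
    by (simp add: nonadaptive_policies_def policies_def question_dyadic)
qed

end

section \<open>Joint law of Z and theta, and the optimal rate\<close>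

lemma (in prob_space) distr_pair_indep:
  assumes Z: "Z \<in> M \<rightarrow>\<^sub>M S" and \<theta>: "\<theta> \<in> M \<rightarrow>\<^sub>M T"
    and indep: "indep_set {Z -` A \<inter> space M | A. A \<in> sets S} {\<theta> -` B \<inter> space M | B. B \<in> sets T}"
  shows "distr M (S \<Otimes>\<^sub>M T) (\<lambda>\<omega>. (Z \<omega>, \<theta> \<omega>)) = distr M S Z \<Otimes>\<^sub>M distr M T \<theta>"
\<comment> \<open>Independence is the product formula on rectangles, and rectangles determine the
  joint law.\<close>
proof (rule pair_measure_eqI[symmetric])
  interpret D1: prob_space "distr M S Z" by (rule prob_space_distr[OF Z])
  interpret D2: prob_space "distr M T \<theta>" by (rule prob_space_distr[OF \<theta>])
  show "sigma_finite_measure (distr M S Z)" "sigma_finite_measure (distr M T \<theta>)" by unfold_locales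
  show "sets (distr M S Z \<Otimes>\<^sub>M distr M T \<theta>) = sets (distr M (S \<Otimes>\<^sub>M T) (\<lambda>\<omega>. (Z \<omega>, \<theta> \<omega>)))"
    by simp
  fix A B assume "A \<in> sets (distr M S Z)" "B \<in> sets (distr M T \<theta>)"
  then have A: "A \<in> sets S" and B: "B \<in> sets T" by auto
  have pair: "(\<lambda>\<omega>. (Z \<omega>, \<theta> \<omega>)) \<in> M \<rightarrow>\<^sub>M S \<Otimes>\<^sub>M T"
    using Z \<theta> by simp
  have "(\<lambda>\<omega>. (Z \<omega>, \<theta> \<omega>)) -` (A \<times> B) \<inter> space M = (Z -` A \<inter> space M) \<inter> (\<theta> -` B \<inter> space M)"
    by auto
  moreover have "prob ((Z -` A \<inter> space M) \<inter> (\<theta> -` B \<inter> space M)) =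
      prob (Z -` A \<inter> space M) * prob (\<theta> -` B \<inter> space M)"
    using A B by (intro indep_setD[OF indep]) auto
  ultimately show "emeasure (distr M S Z) A * emeasure (distr M T \<theta>) B =
      emeasure (distr M (S \<Otimes>\<^sub>M T) (\<lambda>\<omega>. (Z \<omega>, \<theta> \<omega>))) (A \<times> B)"
    using A B by (simp add: emeasure_distr[OF Z] emeasure_distr[OF \<theta>] emeasure_distr[OF pair]
        emeasure_eq_measure ennreal_mult)
qed

theorem theorem4:
  fixes M :: "'a measure" and Z :: "'a \<Rightarrow> real" and \<theta> :: "'a \<Rightarrow> nat \<Rightarrow> real"
    and f0 :: "real \<Rightarrow> real" and k N :: nat
  assumes "k \<ge> 1" and "N \<ge> 1"
    and "prob_space M"
    and "f0 \<in> borel_measurable borel" and "\<And>x. 0 \<le> f0 x"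
    and "\<theta> \<in> M \<rightarrow>\<^sub>M lborel_pow k"
    and "\<And>i. i \<in> {1..k} \<Longrightarrow> distributed M lborel (\<lambda>\<omega>. \<theta> \<omega> i) (\<lambda>x. ennreal (f0 x))"
    and "prob_space.indep_vars M (\<lambda>_. borel) (\<lambda>i \<omega>. \<theta> \<omega> i) {1..k}"
    and "Z \<in> borel_measurable M" and "distr M borel Z = uniform_measure lborel {0..1}"
    and "prob_space.indep_set M {Z -` A \<inter> space M | A. A \<in> sets borel}
           {\<theta> -` B \<inter> space M | B. B \<in> sets (lborel_pow k)}"
    and "integrable (lborel_pow k) (\<lambda>u. prior f0 k u * log 2 (prior f0 k u))"
  shows "entropy_rate M Z \<theta> f0 k (dyadic_policy f0 k) N
           = shannon_entropy (binomial_pmf k (1 / 2))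
       \<and> dyadic_policy f0 k \<in> nonadaptive_policies k N
       \<and> ereal (entropy_rate M Z \<theta> f0 k (dyadic_policy f0 k) N)
           = (SUP \<pi>\<in>nonadaptive_policies k N. ereal (entropy_rate M Z \<theta> f0 k \<pi> N))"
proof -
  interpret M: prob_space M by fact
  note [measurable] = assms(4,6,9)
  have distr_i: "distr M borel (\<lambda>\<omega>. \<theta> \<omega> i) = density lborel (\<lambda>x. ennreal (f0 x))" if "i \<in> {1..k}" for i
  proof -
    have "distr M borel (\<lambda>\<omega>. \<theta> \<omega> i) = distr M lborel (\<lambda>\<omega>. \<theta> \<omega> i)"
      by (intro distr_cong) auto
    then show ?thesis using distributed_distr_eq_density[OF assms(7)[OF that]] by simp
  qed
  have coord: "(\<lambda>\<omega>. \<theta> \<omega> i) \<in> borel_measurable M" if "i \<in> {1..k}" for i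
    using distributed_measurable[OF assms(7)[OF that]] by simp
  \<comment> \<open>As \<open>k >= 1\<close>, there is a first coordinate, and its law is this
    density.\<close>
  have "prob_space (density lborel (\<lambda>x. ennreal (f0 x)))"
    using M.prob_space_distr[OF coord, of 1] distr_i[of 1] \<open>k \<ge> 1\<close> by simp
  then interpret iid_prior f0 k
    using assms by (intro iid_prior.intro)
  let ?U = "uniform_measure lborel {0..1 :: real}"
  have prob_U: "prob_space ?U" by (intro prob_space_uniform_measure) auto
  interpret U: prob_space ?U by (rule prob_U)
  have sets_U: "sets ?U = sets borel" by simp
  have distr_\<theta>: "distr M (lborel_pow k) \<theta> = P"
  proof -
    \<comment> \<open>The values of \<open>\<theta>\<close> are extensional, so
      \<open>\<theta>\<close> equals the tuple of its coordinates, the form in which independence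
      means having a product law.\<close>
    have "distr M (lborel_pow k) \<theta> = distr M (Pi\<^sub>M {1..k} (\<lambda>_. borel)) (\<lambda>\<omega>. \<lambda>i\<in>{1..k}. \<theta> \<omega> i)"
    proof (intro distr_cong refl)
      show "sets (lborel_pow k) = sets (Pi\<^sub>M {1..k} (\<lambda>_. borel))" by (intro sets_PiM_cong) auto
      fix \<omega> assume "\<omega> \<in> space M"
      then have "\<theta> \<omega> \<in> extensional {1..k}"
        using measurable_space[OF assms(6)] by (auto simp: space_PiM PiE_def)
      then show "\<theta> \<omega> = (\<lambda>i\<in>{1..k}. \<theta> \<omega> i)" by (simp add: extensional_restrict)
    qed
    also have "\<dots> = Pi\<^sub>M {1..k} (\<lambda>i. distr M borel (\<lambda>\<omega>. \<theta> \<omega> i))"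
      by (intro M.indep_vars_iff_distr_eq_PiM'[where I = "{1..k}" and M' = "\<lambda>_. borel"
            and X = "\<lambda>i \<omega>. \<theta> \<omega> i", THEN iffD1] coord assms(8)) (use assms(1) in auto)
    also have "\<dots> = P" by (intro PiM_cong refl distr_i)
    finally show ?thesis .
  qed
  have pair: "(\<lambda>\<omega>. (Z \<omega>, \<theta> \<omega>)) \<in> M \<rightarrow>\<^sub>M borel \<Otimes>\<^sub>M lborel_pow k"
    by (intro measurable_Pair assms)
  have joint: "distr M (borel \<Otimes>\<^sub>M lborel_pow k) (\<lambda>\<omega>. (Z \<omega>, \<theta> \<omega>)) = ?U \<Otimes>\<^sub>M P"
    using M.distr_pair_indep[OF assms(9,6,11)] by (simp add: assms(10) distr_\<theta>)
  let ?H = "diff_entropy k (prior f0 k)" and ?b = "binom_entropy k (1 / 2)"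
  let ?h = "\<lambda>\<pi> z. finite_entropy P (answers k N) (\<lambda>u. history k \<pi> z u N)"
  \<comment> \<open>For adaptive policies too, the rate is the mean over \<open>z\<close> of the
    entropy of the history, divided by \<open>N\<close>.\<close>
  have rate: "entropy_rate M Z \<theta> f0 k \<pi> N = (?H - (\<integral>z. ?H - ?h \<pi> z \<partial>?U)) / real N"
    if \<pi>: "\<pi> \<in> policies k N" for \<pi>
  proof -
    have "(\<integral>\<omega>. diff_entropy k (posterior f0 k \<pi> (Z \<omega>) (\<theta> \<omega>) N) \<partial>M) =
        (\<integral>x. diff_entropy k (posterior f0 k \<pi> (fst x) (snd x) N) \<partial>(?U \<Otimes>\<^sub>M P))"
      unfolding joint[symmetric]
      by (subst integral_distr[OF pair measurable_posterior_entropy[OF \<pi>]]) simp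
    then show ?thesis
      by (simp add: entropy_rate_def expected_posterior_entropy(1)[OF \<pi> prob_U sets_U])
  qed
  \<comment> \<open>Non-adaptivity and the dyadic questions are controlled only for \<open>z\<close>
    in [0, 1], which is almost sure.\<close>
  have AE_U: "AE z in ?U. z \<in> {0..1}"
    by (rule AE_uniform_measureI) auto
  have const: "(\<integral>z. c \<partial>?U) = c" for c :: real
    using U.prob_space by simp
  have upper: "entropy_rate M Z \<theta> f0 k \<pi> N \<le> ?b" if \<pi>: "\<pi> \<in> nonadaptive_policies k N" for \<pi>
  proof -
    have pol: "\<pi> \<in> policies k N" using \<pi> by (simp add: nonadaptive_policies_def)
    \<comment> \<open>The origin serves as the reference point at which the common questions of a
      non-adaptive policy are read off.\<close>
    have zero: "(\<lambda>i\<in>{1..k}. 0) \<in> space (lborel_pow k)" by (simp add: space_PiM)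
    have le: "?h \<pi> z \<le> real N * ?b" if z: "z \<in> {0..1}" for z
    proof (rule nonadaptive_history_entropy(1)[OF pol, where A = "\<lambda>n. question k \<pi> z (\<lambda>i\<in>{1..k}. 0) n"])
      fix u n assume "u \<in> space P" "n \<in> {1..N}"
      then show "question k \<pi> z u n = question k \<pi> z (\<lambda>i\<in>{1..k}. 0) n"
        using \<pi> z zero unfolding nonadaptive_policies_def space_P by blast
    qed
    have "?H - real N * ?b = (\<integral>z. ?H - real N * ?b \<partial>?U)" by (simp only: const)
    also have "\<dots> \<le> (\<integral>z. ?H - ?h \<pi> z \<partial>?U)"
    proof (rule integral_mono_AE)
      show "integrable ?U (\<lambda>z. ?H - real N * ?b)" by (rule U.integrable_const)
      show "integrable ?U (\<lambda>z. ?H - ?h \<pi> z)"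
        by (rule expected_posterior_entropy(2)[OF pol prob_U sets_U])
      show "AE z in ?U. ?H - real N * ?b \<le> ?H - ?h \<pi> z"
        using AE_U by eventually_elim (intro diff_left_mono le)
    qed
    finally have "?H - (\<integral>z. ?H - ?h \<pi> z \<partial>?U) \<le> ?b * real N" by argo
    moreover have "0 < real N" using \<open>N \<ge> 1\<close> by simp
    ultimately show ?thesis
      unfolding rate[OF pol] by (simp only: pos_divide_le_eq)
  qed
  have dyadic: "dyadic_policy f0 k \<in> nonadaptive_policies k N" by (rule dyadic_policy_nonadaptive)
  then have pol: "dyadic_policy f0 k \<in> policies k N" by (simp add: nonadaptive_policies_def)
  have eq: "entropy_rate M Z \<theta> f0 k (dyadic_policy f0 k) N = ?b"
  proof -
    have h: "?h (dyadic_policy f0 k) z = real N * ?b" if z: "z \<in> {0..1}" for z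
    proof (rule nonadaptive_history_entropy(2)[OF pol, where A = "dyadic_question f0"])
      show "question k (dyadic_policy f0 k) z u n = dyadic_question f0 n" if "n \<in> {1..N}" for u n
        using that z by (intro question_dyadic) auto
    qed (rule dyadic_questions_indep[OF f0_measurable f0_nonneg prob_f0])
    have "(\<integral>z. ?H - ?h (dyadic_policy f0 k) z \<partial>?U) = (\<integral>z. ?H - real N * ?b \<partial>?U)"
    proof (rule integral_cong_AE)
      show "AE z in ?U. ?H - ?h (dyadic_policy f0 k) z = ?H - real N * ?b"
        using AE_U by eventually_elim (simp only: h)
    qed (rule borel_measurable_integrable[OF expected_posterior_entropy(2)[OF pol prob_U sets_U]]
        borel_measurable_const)+
    also have "\<dots> = ?H - real N * ?b" by (rule const)
    finally show ?thesis
      unfolding rate[OF pol] using \<open>N \<ge> 1\<close> by simp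
  qed
  \<comment> \<open>The upper bound \<open>?b\<close> is attained at the dyadic policy, so it is the
    supremum.\<close>
  have "ereal ?b = (SUP \<pi>\<in>nonadaptive_policies k N. ereal (entropy_rate M Z \<theta> f0 k \<pi> N))"
    using dyadic upper eq by (intro antisym SUP_least) (auto intro!: SUP_upper2[OF dyadic])
  with dyadic show ?thesis by (simp add: eq shannon_entropy_binomial_half)
qed

end
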